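(* In the setting described in the context, suppose the step-size $\mu>0$ is such that the recursion is mean-square stable, i.e. $\rho(\mathcal{C}^\top(I_{2MN}-\mu\mathcal{R}))<1$ and $\rho(\mathcal{F})<1$. Let $\tilde\alpha_\infty=\lim_{i\to\infty}\mathbb{E}\tilde{\boldsymbol\alpha}_i$ and $q=h+2\,\mathcal{U}\tilde\alpha_\infty$. Then for every positive semidefinite $2MN\times2MN$ matrix $\Sigma$, $$\lim_{i\to\infty}\mathbb{E}\big[\tilde{\boldsymbol\alpha}_i^\top\Sigma\,\tilde{\boldsymbol\alpha}_i\big]=q^\top(I-\mathcal{F})^{-1}\mathrm{vec}(\Sigma).$$ In particular the network mean-square-deviation is $$\mathsf{MSD}^{\text{network}}:=\lim_{i\to\infty}\frac1N\sum_{k=1}^N\mathbb{E}\|\tilde{\boldsymbol\alpha}_{k,i}\|^2=\frac1N\,q^\top(I-\mathcal{F})^{-1}\mathrm{vec}(I_{2MN}),$$ and the mean-square-deviation of agent $k$ is $$\mathsf{MSD}_k:=\lim_{i\to\infty}\mathbb{E}\|\tilde{\boldsymbol\alpha}_{k,i}\|^2=q^\top(I-\mathcal{F})^{-1}\mathrm{vec}(\mathcal{J}_k),$$ where $\mathcal{J}_k$ is the block-diagonal matrix with $N$ blocks of size $2M\times2M$, all zero except the $k$-th, which is $I_{2M}$.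
   Context: **MDP and features.** $\mathbb{S}=\{1,\dots,S\}$ is a finite state set, $\mathbb{A}$ a finite action set, $\mathcal{P}(s'|s,a)$ a transition kernel, $r(s,a,s')\in\mathbb{R}$ a reward function, $\gamma\in(0,1)$. $\pi(a|s)$ is a target policy, $P^\pi$ is the $S\times S$ matrix with entries $p^\pi_{ss'}=\sum_a\mathcal{P}(s'|s,a)\pi(a|s)$, and $r^\pi\in\mathbb{R}^S$ has entries $r^\pi(s)=\sum_a\pi(a|s)\sum_{s'}\mathcal{P}(s'|s,a)r(s,a,s')$. Each state $s$ has a feature vector $x_s\in\mathbb{R}^M$; $X\in\mathbb{R}^{S\times M}$ has rows $x_s^\top$ and has full column rank. $X$ and $r^\pi$ are bounded. **Agents.** There are $N$ agents. Agent $k$ follows a behavior policy $\phi_k(a|s)$ with stationary state distribution $d^{\phi_k}$ (entries may be zero); $D^{\phi_k}=\mathrm{diag}\{d^{\phi_k}\}$. The importance weight is $\xi_k(a,s)=\pi(a|s)/\phi_k(a|s)$ (implicitly $\phi_k(a|s)>0$ whenever $d^{\phi_k}(s)>0$ and $\pi(a|s)>0$). The data of agent $k$ are i.i.d. over time $i$: $\boldsymbol s_k(i)\sim d^{\phi_k}$, $\boldsymbol a_k(i)\sim\phi_k(\cdot|\boldsymbol s_k(i))$, next state $\boldsymbol s'\sim\mathcal{P}(\cdot|\boldsymbol s_k(i),\boldsymbol a_k(i))$; agents are independent. Write $\boldsymbol x_{k,i}=x_{\boldsymbol s_k(i)}$, $\boldsymbol\delta_{k,i+1}=x_{\boldsymbol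 s_k(i)}-\gamma x_{\boldsymbol s'}$, $\boldsymbol\xi_k(i)=\xi_k(\boldsymbol a_k(i),\boldsymbol s_k(i))$, $\boldsymbol r_k(i+1)=r(\boldsymbol s_k(i),\boldsymbol a_k(i),\boldsymbol s')$. **Network.** $C=[c_{lk}]$ is an $N\times N$ primitive left-stochastic matrix ($c_{lk}\ge0$, $\sum_l c_{lk}=1$ for each $k$). $\tau=(\tau_1,\dots,\tau_N)^\top$ is a vector of non-negative weights summing to one, and $D^{\overline\phi}=\sum_k\tau_kD^{\phi_k}$ is assumed positive definite. **Solution.** $\alpha^o=\mathrm{col}\{0_M,w^o\}$ with $w^o=\big(X^\top D^{\overline\phi}(I_S-\gamma P^\pi)X\big)^{-1}X^\top D^{\overline\phi}r^\pi$, the matrix $X^\top D^{\overline\phi}(I_S-\gamma P^\pi)X$ being invertible. **Algorithm (diffusion GTD).** Fix $\eta>0$ and step-size $\mu>0$. With $$\boldsymbol G_{k,i+1}=\begin{bmatrix}\eta\boldsymbol x_{k,i}\boldsymbol x_{k,i}^\top\boldsymbol\xi_k(i)&\eta\boldsymbol x_{k,i}\boldsymbol\delta_{k,i+1}^\top\boldsymbol\xi_k(i)\\-\boldsymbol\delta_{k,i+1}\boldsymbol x_{k,i}^\top\boldsymbol\xi_k(i)&0_{M\times M}\end{bmatrix},\quad \boldsymbol g_{k,i+1}=\begin{bmatrix}-\eta\boldsymbol x_{k,i}\boldsymbol\xi_k(i)\boldsymbol r_k(i+1)\\0_M\end{bmatrix},$$ each agent updates $\boldsymbol\alpha_{k,i}\in\mathbb{R}^{2M}$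 by $\boldsymbol\psi_{k,i+1}=\boldsymbol\alpha_{k,i}-\mu(\boldsymbol G_{k,i+1}\boldsymbol\alpha_{k,i}+\boldsymbol g_{k,i+1})$, $\boldsymbol\alpha_{k,i+1}=\sum_l c_{lk}\boldsymbol\psi_{l,i+1}$, from deterministic initial values. Errors: $\tilde{\boldsymbol\alpha}_{k,i}=\alpha^o-\boldsymbol\alpha_{k,i}$, $\tilde{\boldsymbol\alpha}_i=\mathrm{col}\{\tilde{\boldsymbol\alpha}_{1,i},\dots,\tilde{\boldsymbol\alpha}_{N,i}\}\in\mathbb{R}^{2MN}$. **Network quantities.** $\mathcal{C}=C\otimes I_{2M}$; $\boldsymbol{\mathcal R}_i=\mathrm{diag}\{\boldsymbol G_{1,i},\dots,\boldsymbol G_{N,i}\}$ (block diagonal); $\boldsymbol{\mathcal G}_i=\mathrm{col}\{\boldsymbol G_{1,i},\dots,\boldsymbol G_{N,i}\}$; $\boldsymbol g_i=\mathrm{col}\{\boldsymbol g_{1,i},\dots,\boldsymbol g_{N,i}\}$; $\boldsymbol n_i=\boldsymbol{\mathcal G}_i\alpha^o+\boldsymbol g_i$; $\mathcal R=\mathbb{E}\boldsymbol{\mathcal R}_i$; $\mathcal R_n=\mathbb{E}[\boldsymbol n_i\boldsymbol n_i^\top]$. The error obeys $\tilde{\boldsymbol\alpha}_{i+1}=\mathcal C^\top(I-\mu\boldsymbol{\mathcal R}_{i+1})\tilde{\boldsymbol\alpha}_i+\mu\,\mathcal C^\top\boldsymbol n_{i+1}$. Further, $$\mathcal F=\big((I-\mu\mathcal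 R^\top)\mathcal C\big)\otimes\big((I-\mu\mathcal R^\top)\mathcal C\big)+\mu^2\,\mathbb{E}\Big[\big((\boldsymbol{\mathcal R}_{i+1}^\top-\mathcal R^\top)\mathcal C\big)\otimes\big((\boldsymbol{\mathcal R}_{i+1}^\top-\mathcal R^\top)\mathcal C\big)\Big],$$ $$\mathcal U=\mu\,\mathbb{E}\big[(\mathcal C^\top\boldsymbol n_{i+1})\otimes(\mathcal C^\top(I-\mu\boldsymbol{\mathcal R}_{i+1}))\big],\qquad h=\mu^2\,\mathrm{vec}[\mathcal C^\top\mathcal R_n\mathcal C].$$ $\mathrm{vec}$ stacks the columns of a matrix; $\rho$ is the spectral radius; $\mathrm{col}$ stacks vertically. *)

theory Defs
  imports "HOL-Probability.Probability"
begin

section \<open>Matrices indexed by finite types\<close>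

text \<open>
  A vector of \<open>\<real>\<^sup>2\<^sup>M\<close> has index type \<open>'m + 'm\<close> and a vector of \<open>\<real>\<^sup>2\<^sup>M\<^sup>N\<close> has index type
  \<open>'n \<times> ('m + 'm)\<close>, the agent being the first component. Index pairs are read in lexicographic
  order: the Kronecker product pairs an index of the left factor with one of the right factor, and
  since \<open>vec\<close> stacks columns, its entry at \<open>(j, i)\<close> is the entry in row \<open>i\<close> and column \<open>j\<close>. The power
  operation of the library acts entrywise on matrices, so powers are written as iterated products.
\<close>

definition outer :: "real^'r \<Rightarrow> real^'c \<Rightarrow> real^'c^'r"
  where "outer u v = (\<chi> i j. u $ i * v $ j)"

definition diag_mat :: "real^'r \<Rightarrow> real^'r^'r"
  where "diag_mat v = (\<chi> i j. if i = j then v $ i else 0)"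

definition kron :: "real^'c^'r \<Rightarrow> real^'d^'q \<Rightarrow> real^('c \<times> 'd)^('r \<times> 'q)"
  where "kron A B = (\<chi> i j. A $ fst i $ fst j * B $ snd i $ snd j)"

text \<open>The case of a left factor with a single column, whose column index is left out.\<close>

definition kron_col :: "real^'r \<Rightarrow> real^'d^'q \<Rightarrow> real^'d^('r \<times> 'q)"
  where "kron_col v B = (\<chi> i j. v $ fst i * B $ snd i $ j)"

definition vec_cols :: "real^'c^'r \<Rightarrow> real^('c \<times> 'r)"
  where "vec_cols A = (\<chi> p. A $ snd p $ fst p)"

definition block_diag :: "('n::finite \<Rightarrow> real^'b^'b) \<Rightarrow> real^('n \<times> 'b)^('n \<times> 'b)"
  where "block_diag B = (\<chi> i j. if fst i = fst j then B (fst i) $ snd i $ snd j else 0)"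

text \<open>This stacks vectors (entries in \<open>\<real>\<close>) as well as matrices (the entries being rows).\<close>

definition col_stack :: "('n::finite \<Rightarrow> 'e^'b) \<Rightarrow> 'e^('n \<times> 'b)"
  where "col_stack v = (\<chi> i. v (fst i) $ snd i)"

definition col2 :: "'e^'b \<Rightarrow> 'e^'d \<Rightarrow> 'e^('b + 'd)"
  where "col2 u v = (\<chi> i. case i of Inl p \<Rightarrow> u $ p | Inr p \<Rightarrow> v $ p)"

definition block2x2 ::
    "real^'c^'r \<Rightarrow> real^'d^'r \<Rightarrow> real^'c^'q \<Rightarrow> real^'d^'q \<Rightarrow> real^('c + 'd)^('r + 'q)"
  where "block2x2 A B C D =
    col2 (\<chi> i. col2 (A $ i) (B $ i)) (\<chi> i. col2 (C $ i) (D $ i))"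

definition pos_semidef :: "real^'r^'r \<Rightarrow> bool"
  where "pos_semidef A \<longleftrightarrow> transpose A = A \<and> (\<forall>v. 0 \<le> v \<bullet> (A *v v))"

definition pos_def :: "real^'r^'r \<Rightarrow> bool"
  where "pos_def A \<longleftrightarrow> transpose A = A \<and> (\<forall>v. v \<noteq> 0 \<longrightarrow> 0 < v \<bullet> (A *v v))"

definition eigenvalues :: "real^'r^'r \<Rightarrow> complex set"
  where "eigenvalues A =
    {z. \<exists>v :: complex^'r. v \<noteq> 0 \<and> map_matrix complex_of_real A *v v = z *s v}"

definition spec_radius :: "real^'r^'r \<Rightarrow> real"
  where "spec_radius A = (SUP z\<in>eigenvalues A. cmod z)"

definition left_stochastic :: "real^'n^'n \<Rightarrow> bool"
  where "left_stochastic C \<longleftrightarrow> (\<forall>l k. 0 \<le> C $ l $ k) \<and> (\<forall>k. (\<Sum>l\<in>UNIV. C $ l $ k) = 1)"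

definition primitive_mat :: "real^'n^'n \<Rightarrow> bool"
  where "primitive_mat C \<longleftrightarrow> (\<forall>l k. 0 \<le> C $ l $ k) \<and>
    (\<exists>m>0. \<forall>l k. 0 < (((**) C ^^ m) (mat 1)) $ l $ k)"


section \<open>Multi-agent off-policy evaluation\<close>

text \<open>
  The row \<open>features S $ s\<close> is the feature vector of state \<open>s\<close>. At time \<open>i\<close>, agent \<open>k\<close> observes the
  sample \<open>(state S k i, act S k i, next_state S k i)\<close> on the probability space \<open>prob_sp S\<close>.
\<close>

record ('s, 'a, 'm, 'n, 'w) gtd =
  kernel :: "'s \<Rightarrow> 'a \<Rightarrow> 's pmf"
  reward :: "'s \<Rightarrow> 'a \<Rightarrow> 's \<Rightarrow> real"
  discount :: real
  target :: "'s \<Rightarrow> 'a pmf"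
  features :: "real^'m^'s"
  behavior :: "'n \<Rightarrow> 's \<Rightarrow> 'a pmf"
  stat_dist :: "'n \<Rightarrow> 's pmf"
  combination :: "real^'n^'n"
  weights :: "real^'n"
  eta :: real
  step_size :: real
  init :: "'n \<Rightarrow> real^('m + 'm)"
  prob_sp :: "'w measure"
  state :: "'n \<Rightarrow> nat \<Rightarrow> 'w \<Rightarrow> 's"
  act :: "'n \<Rightarrow> nat \<Rightarrow> 'w \<Rightarrow> 'a"
  next_state :: "'n \<Rightarrow> nat \<Rightarrow> 'w \<Rightarrow> 's"

definition P_pi :: "('s::finite, 'a::finite, 'm::finite, 'n::finite, 'w) gtd \<Rightarrow> real^'s^'s"
  where "P_pi S = (\<chi> s s'. \<Sum>a\<in>UNIV. pmf (kernel S s a) s' * pmf (target S s) a)"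

definition r_pi :: "('s::finite, 'a::finite, 'm::finite, 'n::finite, 'w) gtd \<Rightarrow> real^'s"
  where "r_pi S = (\<chi> s. \<Sum>a\<in>UNIV. pmf (target S s) a *
    (\<Sum>s'\<in>UNIV. pmf (kernel S s a) s' * reward S s a s'))"

definition importance :: "('s::finite, 'a::finite, 'm::finite, 'n::finite, 'w) gtd \<Rightarrow> 'n \<Rightarrow> 'a \<Rightarrow> 's \<Rightarrow> real"
  where "importance S k a s = pmf (target S s) a / pmf (behavior S k s) a"

definition D_phi :: "('s::finite, 'a::finite, 'm::finite, 'n::finite, 'w) gtd \<Rightarrow> 'n \<Rightarrow> real^'s^'s"
  where "D_phi S k = diag_mat (\<chi> s. pmf (stat_dist S k) s)"

definition D_bar :: "('s::finite, 'a::finite, 'm::finite, 'n::finite, 'w) gtd \<Rightarrow> real^'s^'s"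
  where "D_bar S = (\<Sum>k\<in>UNIV. (weights S $ k) *\<^sub>R D_phi S k)"

definition A_bar :: "('s::finite, 'a::finite, 'm::finite, 'n::finite, 'w) gtd \<Rightarrow> real^'m^'m"
  where "A_bar S = transpose (features S) ** D_bar S **
    (mat 1 - discount S *\<^sub>R P_pi S) ** features S"

definition w_opt :: "('s::finite, 'a::finite, 'm::finite, 'n::finite, 'w) gtd \<Rightarrow> real^'m"
  where "w_opt S = matrix_inv (A_bar S) *v ((transpose (features S) ** D_bar S) *v r_pi S)"

definition alpha_opt :: "('s::finite, 'a::finite, 'm::finite, 'n::finite, 'w) gtd \<Rightarrow> real^('m + 'm)"
  where "alpha_opt S = col2 0 (w_opt S)"

text \<open>
  In everything below that depends on time, the argument \<open>i\<close> is the time of the sample used. Thus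
  \<open>G_mat S k i\<close> is \<open>G\<^sub>k\<^sub>,\<^sub>i\<^sub>+\<^sub>1\<close>, and similarly \<open>delta\<close>, \<open>g_vec\<close>, \<open>R_mat\<close>, \<open>n_vec\<close> are the quantities
  with subscript \<open>i + 1\<close>. The iterates and the errors carry their own subscript \<open>i\<close>.
\<close>

definition x_feat :: "('s::finite, 'a::finite, 'm::finite, 'n::finite, 'w) gtd \<Rightarrow> 'n \<Rightarrow> nat \<Rightarrow> 'w \<Rightarrow> real^'m"
  where "x_feat S k i \<omega> = features S $ state S k i \<omega>"

definition delta :: "('s::finite, 'a::finite, 'm::finite, 'n::finite, 'w) gtd \<Rightarrow> 'n \<Rightarrow> nat \<Rightarrow> 'w \<Rightarrow> real^'m"
  where "delta S k i \<omega> =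
    features S $ state S k i \<omega> - discount S *\<^sub>R features S $ next_state S k i \<omega>"

definition xi :: "('s::finite, 'a::finite, 'm::finite, 'n::finite, 'w) gtd \<Rightarrow> 'n \<Rightarrow> nat \<Rightarrow> 'w \<Rightarrow> real"
  where "xi S k i \<omega> = importance S k (act S k i \<omega>) (state S k i \<omega>)"

definition sample_reward :: "('s::finite, 'a::finite, 'm::finite, 'n::finite, 'w) gtd \<Rightarrow> 'n \<Rightarrow> nat \<Rightarrow> 'w \<Rightarrow> real"
  where "sample_reward S k i \<omega> = reward S (state S k i \<omega>) (act S k i \<omega>) (next_state S k i \<omega>)"

definition G_mat :: "('s::finite, 'a::finite, 'm::finite, 'n::finite, 'w) gtd \<Rightarrow> 'n \<Rightarrow> nat \<Rightarrow> 'w \<Rightarrow> real^('m + 'm)^('m + 'm)"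
  where "G_mat S k i \<omega> = block2x2
    ((eta S * xi S k i \<omega>) *\<^sub>R outer (x_feat S k i \<omega>) (x_feat S k i \<omega>))
    ((eta S * xi S k i \<omega>) *\<^sub>R outer (x_feat S k i \<omega>) (delta S k i \<omega>))
    (- (xi S k i \<omega> *\<^sub>R outer (delta S k i \<omega>) (x_feat S k i \<omega>)))
    0"

definition g_vec :: "('s::finite, 'a::finite, 'm::finite, 'n::finite, 'w) gtd \<Rightarrow> 'n \<Rightarrow> nat \<Rightarrow> 'w \<Rightarrow> real^('m + 'm)"
  where "g_vec S k i \<omega> =
    col2 (- ((eta S * xi S k i \<omega> * sample_reward S k i \<omega>) *\<^sub>R x_feat S k i \<omega>)) 0"

definition adapt :: "('s::finite, 'a::finite, 'm::finite, 'n::finite, 'w) gtd \<Rightarrow> 'n \<Rightarrow> nat \<Rightarrow> 'w \<Rightarrow> real^('m + 'm) \<Rightarrow> real^('m + 'm)"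
  where "adapt S k i \<omega> a = a - step_size S *\<^sub>R (G_mat S k i \<omega> *v a + g_vec S k i \<omega>)"

primrec alpha :: "('s::finite, 'a::finite, 'm::finite, 'n::finite, 'w) gtd \<Rightarrow> nat \<Rightarrow> 'n \<Rightarrow> 'w \<Rightarrow> real^('m + 'm)"
  where
    "alpha S 0 = (\<lambda>k \<omega>. init S k)"
  | "alpha S (Suc i) =
      (\<lambda>k \<omega>. \<Sum>l\<in>UNIV. (combination S $ l $ k) *\<^sub>R adapt S l i \<omega> (alpha S i l \<omega>))"

definition agent_error :: "('s::finite, 'a::finite, 'm::finite, 'n::finite, 'w) gtd \<Rightarrow> nat \<Rightarrow> 'n \<Rightarrow> 'w \<Rightarrow> real^('m + 'm)"
  where "agent_error S i k \<omega> = alpha_opt S - alpha S i k \<omega>"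

definition network_error :: "('s::finite, 'a::finite, 'm::finite, 'n::finite, 'w) gtd \<Rightarrow> nat \<Rightarrow> 'w \<Rightarrow> real^('n \<times> ('m + 'm))"
  where "network_error S i \<omega> = col_stack (\<lambda>k. agent_error S i k \<omega>)"

definition C_net :: "('s::finite, 'a::finite, 'm::finite, 'n::finite, 'w) gtd \<Rightarrow> real^('n \<times> ('m + 'm))^('n \<times> ('m + 'm))"
  where "C_net S = kron (combination S) (mat 1)"

definition R_mat :: "('s::finite, 'a::finite, 'm::finite, 'n::finite, 'w) gtd \<Rightarrow> nat \<Rightarrow> 'w \<Rightarrow> real^('n \<times> ('m + 'm))^('n \<times> ('m + 'm))"
  where "R_mat S i \<omega> = block_diag (\<lambda>k. G_mat S k i \<omega>)"

definition n_vec :: "('s::finite, 'a::finite, 'm::finite, 'n::finite, 'w) gtd \<Rightarrow> nat \<Rightarrow> 'w \<Rightarrow> real^('n \<times> ('m + 'm))"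
  where "n_vec S i \<omega> =
    col_stack (\<lambda>k. G_mat S k i \<omega>) *v alpha_opt S + col_stack (\<lambda>k. g_vec S k i \<omega>)"

text \<open>
  The samples being identically distributed over time, the moments below do not depend on the time
  index; they are taken at the first sample.
\<close>

definition R_mean :: "('s::finite, 'a::finite, 'm::finite, 'n::finite, 'w) gtd \<Rightarrow> real^('n \<times> ('m + 'm))^('n \<times> ('m + 'm))"
  where "R_mean S = (\<integral>\<omega>. R_mat S 0 \<omega> \<partial>prob_sp S)"

definition R_noise :: "('s::finite, 'a::finite, 'm::finite, 'n::finite, 'w) gtd \<Rightarrow> real^('n \<times> ('m + 'm))^('n \<times> ('m + 'm))"
  where "R_noise S = (\<integral>\<omega>. outer (n_vec S 0 \<omega>) (n_vec S 0 \<omega>) \<partial>prob_sp S)"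

definition F_mat :: "('s::finite, 'a::finite, 'm::finite, 'n::finite, 'w) gtd \<Rightarrow>
    real^(('n \<times> ('m + 'm)) \<times> ('n \<times> ('m + 'm)))^(('n \<times> ('m + 'm)) \<times> ('n \<times> ('m + 'm)))"
  where "F_mat S =
    kron ((mat 1 - step_size S *\<^sub>R transpose (R_mean S)) ** C_net S)
         ((mat 1 - step_size S *\<^sub>R transpose (R_mean S)) ** C_net S)
    + (step_size S)\<^sup>2 *\<^sub>R
      (\<integral>\<omega>. kron ((transpose (R_mat S 0 \<omega>) - transpose (R_mean S)) ** C_net S)
                 ((transpose (R_mat S 0 \<omega>) - transpose (R_mean S)) ** C_net S) \<partial>prob_sp S)"

definition U_mat :: "('s::finite, 'a::finite, 'm::finite, 'n::finite, 'w) gtd \<Rightarrow>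
    real^('n \<times> ('m + 'm))^(('n \<times> ('m + 'm)) \<times> ('n \<times> ('m + 'm)))"
  where "U_mat S = step_size S *\<^sub>R
    (\<integral>\<omega>. kron_col (transpose (C_net S) *v n_vec S 0 \<omega>)
                   (transpose (C_net S) ** (mat 1 - step_size S *\<^sub>R R_mat S 0 \<omega>)) \<partial>prob_sp S)"

definition h_vec :: "('s::finite, 'a::finite, 'm::finite, 'n::finite, 'w) gtd \<Rightarrow> real^(('n \<times> ('m + 'm)) \<times> ('n \<times> ('m + 'm)))"
  where "h_vec S =
    (step_size S)\<^sup>2 *\<^sub>R vec_cols (transpose (C_net S) ** R_noise S ** C_net S)"

definition mean_error :: "('s::finite, 'a::finite, 'm::finite, 'n::finite, 'w) gtd \<Rightarrow> nat \<Rightarrow> real^('n \<times> ('m + 'm))"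
  where "mean_error S i = (\<integral>\<omega>. network_error S i \<omega> \<partial>prob_sp S)"

definition error_limit :: "('s::finite, 'a::finite, 'm::finite, 'n::finite, 'w) gtd \<Rightarrow> real^('n \<times> ('m + 'm))"
  where "error_limit S = lim (mean_error S)"

definition q_vec :: "('s::finite, 'a::finite, 'm::finite, 'n::finite, 'w) gtd \<Rightarrow> real^(('n \<times> ('m + 'm)) \<times> ('n \<times> ('m + 'm)))"
  where "q_vec S = h_vec S + 2 *\<^sub>R (U_mat S *v error_limit S)"

definition J_mat :: "'n::finite \<Rightarrow> real^('n \<times> 'b::finite)^('n \<times> 'b)"
  where "J_mat k = block_diag (\<lambda>l. if l = k then mat 1 else 0)"

text \<open>
  Boundedness of the features and rewards needs no assumption, since all index types are finite.
  The joint independence of the samples covers both the agents and the times.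
\<close>

locale gtd_setting =
  fixes S :: "('s::finite, 'a::finite, 'm::finite, 'n::finite, 'w) gtd"
  assumes discount: "0 < discount S" "discount S < 1"
    and full_column_rank: "rank (features S) = CARD('m)"
    and coverage: "\<And>k s a. 0 < pmf (stat_dist S k) s \<Longrightarrow> 0 < pmf (target S s) a \<Longrightarrow>
      0 < pmf (behavior S k s) a"
    and stationary: "\<And>k. bind_pmf (stat_dist S k)
      (\<lambda>s. bind_pmf (behavior S k s) (\<lambda>a. kernel S s a)) = stat_dist S k"
    and combination: "left_stochastic (combination S)" "primitive_mat (combination S)"
    and weights: "\<And>k. 0 \<le> weights S $ k" "(\<Sum>k\<in>UNIV. weights S $ k) = 1"
    and D_bar_pos_def: "pos_def (D_bar S)"
    and A_bar_invertible: "invertible (A_bar S)"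
    and eta_pos: "0 < eta S"
    and step_size_pos: "0 < step_size S"
    and prob_space: "prob_space (prob_sp S)"
    and samples_indep: "prob_space.indep_vars (prob_sp S) (\<lambda>_. count_space UNIV)
      (\<lambda>(k, i) \<omega>. (state S k i \<omega>, act S k i \<omega>, next_state S k i \<omega>)) UNIV"
    and samples_distr: "\<And>k i. distr (prob_sp S) (count_space UNIV)
        (\<lambda>\<omega>. (state S k i \<omega>, act S k i \<omega>, next_state S k i \<omega>)) =
      measure_pmf (bind_pmf (stat_dist S k) (\<lambda>s. bind_pmf (behavior S k s) (\<lambda>a.
        map_pmf (\<lambda>s'. (s, a, s')) (kernel S s a))))"

end

theory Submission
  imports Defs "HOL-Computational_Algebra.Fundamental_Theorem_Algebra"
begin

text \<open>
  The network error satisfies an affine recursion \<open>e\<^sub>i\<^sub>+\<^sub>1 = A(Y\<^sub>i) e\<^sub>i + v(Y\<^sub>i)\<close> in which \<open>Y\<^sub>i\<close>, the joint sample of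
  all agents, is i.i.d. and finitely valued, so \<open>Y\<^sub>i\<close> is independent of \<open>e\<^sub>i\<close>. Hence the mean \<open>m\<^sub>i\<close> and the
  vectorised second moment \<open>z\<^sub>i\<close> obey \<open>m\<^sub>i\<^sub>+\<^sub>1 = E[A] m\<^sub>i + E[v]\<close> and
  \<open>z\<^sub>i\<^sub>+\<^sub>1 = F\<^sup>T z\<^sub>i + h + U m\<^sub>i + (U m\<^sub>i)'\<close>, where the prime swaps the two tensor factors, and both
  converge because the spectral radii are below one. Pairing the limit equation for \<open>z\<close> with the
  symmetric vector \<open>(I - F)\<^sup>-\<^sup>1 vec \<Sigma>\<close> gives the formula.

  Convergence needs no normal form of \<open>F\<close>: some polynomial \<open>p \<noteq> 0\<close> annihilates \<open>F\<close>, and its roots are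
  removed one at a time.
\<close>

section \<open>Linear recursions below spectral radius one\<close>

text \<open>This is \<open>p(A) x\<close> evaluated by Horner's scheme. Acting on a vector keeps the
  recursion \<open>pCons\<close> by \<open>pCons\<close> and avoids matrix powers, because the power
  operation on matrices is entrywise.\<close>

definition poly_mat_action :: "'a::field^'d^'d \<Rightarrow> 'a poly \<Rightarrow> 'a^'d \<Rightarrow> 'a^'d"
  where "poly_mat_action A p x = fold_coeffs (\<lambda>a y. a *s x + A *v y) p 0"

lemma poly_mat_action_0 [simp]: "poly_mat_action A 0 x = 0"
  by (simp add: poly_mat_action_def)

lemma poly_mat_action_pCons [simp]:
  "poly_mat_action A (pCons a p) x = a *s x + A *v poly_mat_action A p x"
\<comment> \<open>Folding over \<open>pCons a p\<close> processes \<open>a\<close> unless the whole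
  polynomial is zero, and then both sides vanish.\<close>
proof (cases "p = 0 \<and> a = 0")
  case False
  then show ?thesis by (auto simp: poly_mat_action_def)
qed (simp add: poly_mat_action_def)

lemma poly_mat_action_add:
  "poly_mat_action A (p + q) x = poly_mat_action A p x + poly_mat_action A q x"
  by (induction p q rule: poly_induct2)
    (simp_all add: matrix_vector_right_distrib vector_sadd_rdistrib)

lemma poly_mat_action_smult:
  "poly_mat_action A (smult c p) x = c *s poly_mat_action A p x"
  by (induction p) (simp_all add: vector_add_ldistrib vector_smult_assoc vector_scalar_commute)

lemma poly_mat_action_mult_vec:
  "poly_mat_action A p (A *v x) = A *v poly_mat_action A p x"
  by (induction p) (simp_all add: matrix_vector_right_distrib vector_scalar_commute)

lemma poly_mat_action_add_vec:
  "poly_mat_action A p (x + y) = poly_mat_action A p x + poly_mat_action A p y"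
  by (induction p) (simp_all add: matrix_vector_right_distrib vector_add_ldistrib)

lemma poly_mat_action_scale_vec:
  "poly_mat_action A p (c *s x) = c *s poly_mat_action A p x"
  by (induction p)
    (simp_all add: vector_add_ldistrib vector_smult_assoc vector_scalar_commute mult.commute)

lemma poly_mat_action_linear_factor:
  fixes A :: "'a::field^'d^'d"
  shows "poly_mat_action A ([:-l, 1:] * q) x = A *v poly_mat_action A q x - l *s poly_mat_action A q x"
proof -
  have "[:-l, 1:] * q = smult (-l) q + pCons 0 q" by simp
  then show ?thesis
    by (simp only: poly_mat_action_add poly_mat_action_smult poly_mat_action_pCons) simp
qed

lemma poly_mat_action_sum:
  "poly_mat_action A (sum p I) x = (\<Sum>i\<in>I. poly_mat_action A (p i) x)"
  by (induction I rule: infinite_finite_induct) (simp_all add: poly_mat_action_add)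

lemma poly_mat_action_monom:
  "poly_mat_action A (monom c n) x = c *s (((**) A ^^ n) (mat 1) *v x)"
  by (induction n)
    (simp_all add: monom_0 monom_Suc vector_scalar_commute matrix_vector_mul_assoc[symmetric])

text \<open>The powers of \<open>A\<close> with exponents up to the real dimension of the matrix
  space are one too many to be independent. A linear relation among them gives the polynomial, so
  Cayley-Hamilton is avoided.\<close>

lemma annihilating_poly_exists:
  fixes A :: "complex^'d::finite^'d"
  shows "\<exists>p. p \<noteq> 0 \<and> (\<forall>x. poly_mat_action A p x = 0)"
proof -
  define W where "W n = ((**) A ^^ n) (mat 1)" for n
  define N where "N = DIM(complex^'d^'d)"
  have "\<exists>u :: nat \<Rightarrow> real. (\<exists>i\<le>N. u i \<noteq> 0) \<and> (\<Sum>i\<le>N. u i *\<^sub>R W i) = 0"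
  \<comment> \<open>Dependence is a statement about sets, so the case of two coinciding powers is
    separate; there the relation is \<open>W i - W j = 0\<close>.\<close>
  proof (cases "inj_on W {..N}")
    case True
    then have "\<not> card (W ` {..N}) \<le> DIM(complex^'d^'d)"
      by (simp add: card_image N_def)
    then have "dependent (W ` {..N})"
      using independent_bound by blast
    then obtain u where u: "\<exists>v\<in>W ` {..N}. u v \<noteq> 0" "(\<Sum>v\<in>W ` {..N}. u v *\<^sub>R v) = 0"
      by (auto simp: dependent_finite)
    have "(\<Sum>i\<le>N. u (W i) *\<^sub>R W i) = 0"
      using u(2) by (simp add: sum.reindex[OF True])
    then show ?thesis using u(1) by (intro exI[of _ "u \<circ> W"]) auto
  next
    case False
    then obtain i j where ij: "i \<le> N" "j \<le> N" "i \<noteq> j" "W i = W j"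
      by (auto simp: inj_on_def)
    define u where "u k = (if k = i then 1 else if k = j then -1 else (0::real))" for k
    have "(\<Sum>k\<le>N. u k *\<^sub>R W k) = (\<Sum>k\<in>{i, j}. u k *\<^sub>R W k)"
      using ij by (intro sum.mono_neutral_right) (auto simp: u_def)
    also have "\<dots> = 0" using ij by (simp add: u_def)
    finally show ?thesis using ij by (intro exI[of _ u]) (auto simp: u_def)
  qed
  then obtain u i where u: "i \<le> N" "u i \<noteq> 0" "(\<Sum>i\<le>N. u i *\<^sub>R W i) = 0"
    by blast
  define p where "p = (\<Sum>i\<le>N. monom (complex_of_real (u i)) i)"
  have "coeff p i = complex_of_real (u i)"
    using u(1) by (simp add: p_def coeff_sum)
  then have "p \<noteq> 0" using u(2) by auto
  moreover have "poly_mat_action A p x = 0" for x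
  proof -
    have "poly_mat_action A p x = (\<Sum>i\<le>N. complex_of_real (u i) *s (W i *v x))"
      by (simp add: p_def poly_mat_action_sum poly_mat_action_monom W_def)
    also have "\<dots> = (\<Sum>i\<le>N. u i *\<^sub>R W i) *v x"
      unfolding vec_eq_iff matrix_vector_mult_def
      by (simp add: sum_distrib_left sum_distrib_right mult.assoc)
        (simp add: scaleR_conv_of_real mult.assoc, intro allI sum.swap)
    finally show ?thesis by (simp add: u(3))
  qed
  ultimately show ?thesis by blast
qed

section \<open>Limits of scalar and complex vector recursions\<close>

lemma tendsto_matrix_vector_mult [tendsto_intros]:
  fixes A :: "'a::{real_normed_algebra_1,comm_ring_1}^'d^'e"
  assumes "(f \<longlongrightarrow> x) F"
  shows "((\<lambda>k. A *v f k) \<longlongrightarrow> A *v x) F"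
  by (rule vec_tendstoI) (auto simp: matrix_vector_mult_def intro!: tendsto_intros assms)

lemma tendsto_scalar_vec_mult:
  fixes c :: "'a::{real_normed_algebra_1,comm_ring_1}"
  assumes "(f \<longlongrightarrow> x) F"
  shows "((\<lambda>k. c *s f k) \<longlongrightarrow> c *s x) F"
  by (rule vec_tendstoI) (auto intro!: tendsto_intros assms)

lemma contractive_recursion_tendsto_zero:
  fixes a b :: "nat \<Rightarrow> real"
  assumes nonneg: "\<And>k. 0 \<le> a k" and le: "\<And>k. a (Suc k) \<le> r * a k + b k"
    and r: "0 \<le> r" "r < 1" and b: "b \<longlonglongrightarrow> 0"
  shows "a \<longlonglongrightarrow> 0"
proof (rule LIMSEQ_I)
  fix e :: real assume e: "0 < e"
  \<comment> \<open>The threshold is chosen so that \<open>e / 2\<close> is the fixed point of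
    \<open>t \<mapsto> r * t + e / 2 * (1 - r)\<close>; the excess over \<open>e / 2\<close> then
    decays geometrically.\<close>
  from e r have "eventually (\<lambda>k. b k < e / 2 * (1 - r)) sequentially"
    by (intro order_tendstoD[OF b]) simp
  then obtain N where N: "\<And>k. k \<ge> N \<Longrightarrow> b k < e / 2 * (1 - r)"
    by (auto simp: eventually_sequentially)
  have step: "a (N + j) \<le> r ^ j * a N + e / 2" for j
  proof (induction j)
    case (Suc j)
    have "a (N + Suc j) \<le> r * a (N + j) + b (N + j)" using le[of "N + j"] by simp
    also have "\<dots> \<le> r * (r ^ j * a N + e / 2) + e / 2 * (1 - r)"
      using N[of "N + j"] by (intro add_mono mult_left_mono Suc r) auto
    finally show ?case by (simp add: field_simps)
  qed (use e in simp)
  have "(\<lambda>j. r ^ j * a N) \<longlonglongrightarrow> 0 * a N"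
    by (intro tendsto_mult tendsto_const LIMSEQ_power_zero) (use r in simp)
  then have "eventually (\<lambda>j. r ^ j * a N < e / 2) sequentially"
    using e by (intro order_tendstoD(2)) auto
  then obtain J where J: "\<And>j. j \<ge> J \<Longrightarrow> r ^ j * a N < e / 2"
    by (auto simp: eventually_sequentially)
  have "norm (a k - 0) < e" if "k \<ge> N + J" for k
  proof -
    have "J \<le> k - N" using that by simp
    then show ?thesis using step[of "k - N"] J[of "k - N"] that nonneg[of k] by simp
  qed
  then show "\<exists>no. \<forall>n\<ge>no. norm (a n - 0) < e" by blast
qed

lemma norm_vector_scalar_mult_complex:
  fixes x :: "complex^'d"
  shows "norm (c *s x) = cmod c * norm x"
  by (simp add: norm_vec_def L2_set_def norm_mult power_mult_distrib real_sqrt_mult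
      flip: sum_distrib_left)

text \<open>
  Induction on the degree of \<open>p\<close>: a root \<open>l\<close> of \<open>p\<close> with \<open>\<bar>l\<bar> < 1\<close> reduces the claim to the scalar
  recursion with factor \<open>l\<close>, and a root with \<open>\<bar>l\<bar> \<ge> 1\<close> can be cancelled because \<open>A - l\<close> is invertible.
\<close>

lemma stable_recursion_complex_tendsto_zero:
  fixes A :: "complex^'d::finite^'d" and z :: "nat \<Rightarrow> complex^'d"
  assumes inv: "\<And>l. 1 \<le> cmod l \<Longrightarrow> \<exists>B. B ** (A - mat l) = mat 1"
    and "p \<noteq> 0" and "(\<lambda>k. poly_mat_action A p (z k)) \<longlonglongrightarrow> 0"
    and "(\<lambda>k. z (Suc k) - A *v z k) \<longlonglongrightarrow> 0"
  shows "z \<longlonglongrightarrow> 0"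
  using assms(2-)
proof (induction "degree p" arbitrary: p z)
  case 0
  then obtain c where p: "p = [:c:]" by (metis degree_eq_zeroE)
  then have "(\<lambda>k. inverse c *s (c *s z k)) \<longlonglongrightarrow> inverse c *s 0"
    using 0 by (intro tendsto_scalar_vec_mult) simp
  then show ?case using 0 p by (simp add: vector_smult_assoc)
next
  case (Suc n)
  have "\<not> constant (poly p)"
    using Suc.hyps(2) by (simp add: constant_degree)
  then obtain l where "poly p l = 0" using fundamental_theorem_of_algebra by blast
  then obtain q where q: "p = [:-l, 1:] * q" using poly_eq_0_iff_dvd by (metis dvdE)
  have q0: "q \<noteq> 0" using q Suc.prems(1) by auto
  have "degree p = Suc (degree q)"
    unfolding q using q0 by (subst degree_mult_eq) auto
  then have n: "n = degree q" using Suc.hyps(2) by simp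
  have factor: "(\<lambda>k. A *v poly_mat_action A q (z k) - l *s poly_mat_action A q (z k)) \<longlonglongrightarrow> 0"
    using Suc.prems(2) by (simp only: q poly_mat_action_linear_factor)
  show ?case
  proof (cases "cmod l < 1")
    case True
    \<comment> \<open>The sequence \<open>u\<close> is \<open>(A - l) z\<close>. It inherits an
      asymptotically vanishing defect, and \<open>q(A) u = p(A) z\<close> because polynomials in
      \<open>A\<close> commute with \<open>A\<close>, so the induction hypothesis applies to
      \<open>q\<close> and \<open>u\<close>.\<close>
    define u where "u k = A *v z k + (- l) *s z k" for k
    have "u \<longlonglongrightarrow> 0"
    proof (rule Suc.hyps(1)[OF n q0])
      show "(\<lambda>k. poly_mat_action A q (u k)) \<longlonglongrightarrow> 0"
        using factor unfolding u_def
        by (simp only: poly_mat_action_add_vec poly_mat_action_scale_vec poly_mat_action_mult_vec) simp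
      have "u (Suc k) - A *v u k
          = A *v (z (Suc k) - A *v z k) + (- l) *s (z (Suc k) - A *v z k)" for k
        unfolding u_def
        by (simp add: matrix_vector_mult_diff_distrib matrix_vector_right_distrib
            vector_scalar_commute vector_ssub_ldistrib vector_sneg_minus1[symmetric] algebra_simps)
      moreover have "(\<lambda>k. A *v (z (Suc k) - A *v z k) + (- l) *s (z (Suc k) - A *v z k))
          \<longlonglongrightarrow> A *v 0 + (- l) *s 0"
        by (intro tendsto_add tendsto_matrix_vector_mult tendsto_scalar_vec_mult Suc.prems(3))
      ultimately show "(\<lambda>k. u (Suc k) - A *v u k) \<longlonglongrightarrow> 0" by simp
    qed
    \<comment> \<open>Adding the defect replaces \<open>A *v z k\<close> by
      \<open>z (Suc k)\<close>, which turns \<open>u\<close> into the defect of the scalar recursion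
      with factor \<open>l\<close>.\<close>
    then have "(\<lambda>k. u k + (z (Suc k) - A *v z k)) \<longlonglongrightarrow> 0 + 0"
      using Suc.prems(3) by (rule tendsto_add)
    then have lim: "(\<lambda>k. z (Suc k) - l *s z k) \<longlonglongrightarrow> 0"
      by (simp add: u_def)
    have "(\<lambda>k. norm (z k)) \<longlonglongrightarrow> 0"
    proof (rule contractive_recursion_tendsto_zero)
      show "norm (z (Suc k)) \<le> cmod l * norm (z k) + norm (z (Suc k) - l *s z k)" for k
        using norm_triangle_sub[of "z (Suc k)" "l *s z k"]
        by (simp add: norm_vector_scalar_mult_complex)
      show "(\<lambda>k. norm (z (Suc k) - l *s z k)) \<longlonglongrightarrow> 0"
        using lim by (rule tendsto_norm_zero)
    qed (use True in auto)
    then show ?thesis by (simp add: tendsto_norm_zero_iff)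
  next
    case False
    then obtain B where B: "B ** (A - mat l) = mat 1" using inv by fastforce
    have matl: "mat l *v x = l *s x" for x :: "complex^'d"
      by (simp add: vec_eq_iff matrix_vector_mult_def mat_def if_distrib if_distribR cong: if_cong)
    have "(\<lambda>k. B *v (A *v poly_mat_action A q (z k) - l *s poly_mat_action A q (z k))) \<longlonglongrightarrow> B *v 0"
      by (intro tendsto_matrix_vector_mult factor)
    moreover have "B *v (A *v x - l *s x) = x" for x
    proof -
      have "B *v (A *v x - l *s x) = (B ** (A - mat l)) *v x"
        by (simp add: matrix_vector_mul_assoc[symmetric] matrix_vector_mult_diff_rdistrib matl)
      then show ?thesis by (simp add: B)
    qed
    ultimately have "(\<lambda>k. poly_mat_action A q (z k)) \<longlonglongrightarrow> 0" by simp
    then show ?thesis using Suc.hyps(1)[OF n q0] Suc.prems(3) by blast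
  qed
qed

section \<open>Eigenvalues and the spectral radius\<close>

lemma cmod_eigenvalue_le_spec_radius:
  fixes A :: "real^'d::finite^'d"
  assumes "l \<in> eigenvalues A"
  shows "cmod l \<le> spec_radius A"
proof -
  \<comment> \<open>The supremum in \<open>spec_radius\<close> bounds its elements only if the set
    is bounded above. The bound comes from reading the eigenvector equation at a coordinate of
    maximal modulus \<open>m\<close>.\<close>
  have "bdd_above (cmod ` eigenvalues A)"
  proof (rule bdd_aboveI2)
    fix l assume "l \<in> eigenvalues A"
    then obtain v :: "complex^'d"
      where v: "v \<noteq> 0" "map_matrix complex_of_real A *v v = l *s v"
      by (auto simp: eigenvalues_def)
    define m where "m = Max (range (\<lambda>i. cmod (v $ i)))"
    have le: "cmod (v $ j) \<le> m" for j unfolding m_def by (intro Max_ge) auto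
    have "m \<in> range (\<lambda>i. cmod (v $ i))" unfolding m_def by (intro Max_in) auto
    then obtain i where i: "m = cmod (v $ i)" by auto
    obtain j where "v $ j \<noteq> 0" using v(1) by (auto simp: vec_eq_iff)
    then have m: "m > 0" using le[of j] by (smt (verit) zero_less_norm_iff)
    have "cmod l * m = cmod ((l *s v) $ i)" by (simp add: i norm_mult)
    also have "\<dots> = cmod (\<Sum>j\<in>UNIV. complex_of_real (A $ i $ j) * v $ j)"
      by (simp flip: v(2)) (simp add: matrix_vector_mult_def map_matrix_def)
    also have "\<dots> \<le> (\<Sum>j\<in>UNIV. \<bar>A $ i $ j\<bar> * m)"
      by (rule sum_norm_le) (simp add: norm_mult mult_left_mono le)
    also have "\<dots> \<le> (\<Sum>i\<in>UNIV. \<Sum>j\<in>UNIV. \<bar>A $ i $ j\<bar>) * m"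
      unfolding sum_distrib_right
      by (rule member_le_sum[where f = "\<lambda>i. \<Sum>j\<in>UNIV. \<bar>A $ i $ j\<bar> * m"])
        (use m in \<open>auto intro!: sum_nonneg\<close>)
    finally show "cmod l \<le> (\<Sum>i\<in>UNIV. \<Sum>j\<in>UNIV. \<bar>A $ i $ j\<bar>)" using m by simp
  qed
  then show ?thesis unfolding spec_radius_def by (intro cSUP_upper assms)
qed

text \<open>A nonzero kernel vector of \<open>A - l\<close> would be an eigenvector for
  \<open>l\<close>, of modulus at least one. So the kernel is trivial, which for matrices is left
  invertibility.\<close>

lemma left_inverse_outside_spec_radius:
  fixes A :: "real^'d::finite^'d"
  assumes "spec_radius A < 1" "1 \<le> cmod l"
  shows "\<exists>B. B ** (map_matrix complex_of_real A - mat l) = mat 1"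
  unfolding matrix_left_invertible_ker
proof (intro allI impI)
  fix x :: "complex^'d" assume "(map_matrix complex_of_real A - mat l) *v x = 0"
  then have "map_matrix complex_of_real A *v x = mat l *v x"
    by (simp add: matrix_vector_mult_diff_rdistrib)
  also have "mat l *v x = l *s x"
    by (simp add: vec_eq_iff matrix_vector_mult_def mat_def if_distrib if_distribR cong: if_cong)
  finally have "x \<noteq> 0 \<Longrightarrow> l \<in> eigenvalues A" by (auto simp: eigenvalues_def)
  then show "x = 0" using cmod_eigenvalue_le_spec_radius[of l A] assms by fastforce
qed

lemma transpose_diff: "transpose (A - B) = transpose A - transpose (B :: 'a::ab_group_add^'n^'m)"
  by (simp add: transpose_def vec_eq_iff)

text \<open>The second moment evolves under the transpose of the matrix whose spectral radius is
  assumed small. Transposing turns a right inverse into a left one, and for square matrices the two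
  coincide.\<close>

lemma left_inverse_outside_spec_radius_transpose:
  fixes A :: "real^'d::finite^'d"
  assumes "spec_radius A < 1" "1 \<le> cmod l"
  shows "\<exists>B. B ** (map_matrix complex_of_real (transpose A) - mat l) = mat 1"
proof -
  have "map_matrix complex_of_real (transpose A) - mat l
      = transpose (map_matrix complex_of_real A - mat l)"
    by (simp add: transpose_diff) (simp add: transpose_def map_matrix_def vec_eq_iff)
  then show ?thesis
    using left_inverse_outside_spec_radius[OF assms]
    by (metis left_invertible_transpose matrix_left_right_inverse)
qed

lemma matrix_inv_inverse:
  fixes A :: "'a::semiring_1^'n^'m"
  assumes "invertible A"
  shows "A ** matrix_inv A = mat 1" "matrix_inv A ** A = mat 1"
  using someI_ex[OF assms[unfolded invertible_def]] by (auto simp: matrix_inv_def)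

text \<open>A real kernel vector of \<open>mat 1 - A\<close>, read as a complex vector, would be an
  eigenvector for 1.\<close>

lemma invertible_mat_1_minus:
  fixes A :: "real^'d::finite^'d"
  assumes "spec_radius A < 1"
  shows "invertible (mat 1 - A)"
  unfolding invertible_left_inverse matrix_left_invertible_ker
proof (intro allI impI)
  fix x assume "(mat 1 - A) *v x = 0"
  then have Ax: "A *v x = x" by (simp add: matrix_vector_mult_diff_rdistrib)
  have "x = 0" if "(\<chi> i. complex_of_real (x $ i)) = 0"
    using that by (simp add: vec_eq_iff)
  moreover have "map_matrix complex_of_real A *v (\<chi> i. complex_of_real (x $ i))
      = 1 *s (\<chi> i. complex_of_real ((A *v x) $ i))"
    by (simp add: vec_eq_iff matrix_vector_mult_def map_matrix_def)
  ultimately have "x \<noteq> 0 \<Longrightarrow> 1 \<in> eigenvalues A"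
    by (auto simp: eigenvalues_def Ax)
  then show "x = 0" using cmod_eigenvalue_le_spec_radius[of 1 A] assms by fastforce
qed

lemma invertible_mat_1_minus_transpose:
  fixes A :: "real^'d::finite^'d"
  assumes "spec_radius A < 1"
  shows "invertible (mat 1 - transpose A)"
proof -
  have "mat 1 - transpose A = transpose (mat 1 - A)" by (simp add: transpose_diff)
  then show ?thesis using invertible_mat_1_minus[OF assms] by (simp add: transpose_invertible)
qed

section \<open>Real recursions with a convergent forcing term\<close>

lemma stable_recursion_tendsto_zero:
  fixes A :: "real^'d::finite^'d" and z :: "nat \<Rightarrow> real^'d"
  assumes inv: "\<And>l. 1 \<le> cmod l \<Longrightarrow> \<exists>B. B ** (map_matrix complex_of_real A - mat l) = mat 1"
    and rec: "(\<lambda>k. z (Suc k) - A *v z k) \<longlonglongrightarrow> 0"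
  shows "z \<longlonglongrightarrow> 0"
proof -
  define c where "c x = (\<chi> i. complex_of_real (x $ i))" for x :: "real^'d"
  have c_mult: "map_matrix complex_of_real A *v c x = c (A *v x)" for x
    by (simp add: c_def vec_eq_iff matrix_vector_mult_def map_matrix_def)
  obtain p where p: "p \<noteq> 0" "\<And>x. poly_mat_action (map_matrix complex_of_real A) p x = 0"
    using annihilating_poly_exists by blast
  \<comment> \<open>The complex lemma wants \<open>p(A)\<close> applied to the sequence to tend to
    zero; for an annihilating \<open>p\<close> it is identically zero.\<close>
  have "(\<lambda>k. c (z k)) \<longlonglongrightarrow> 0"
  proof (rule stable_recursion_complex_tendsto_zero[OF inv p(1)])
    have "(\<lambda>k. c (z (Suc k) - A *v z k)) \<longlonglongrightarrow> 0"
      using tendsto_of_real[OF tendsto_vec_nth[OF rec]] by (intro vec_tendstoI) (simp add: c_def)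
    moreover have "c (z (Suc k) - A *v z k) = c (z (Suc k)) - map_matrix complex_of_real A *v c (z k)" for k
      by (simp only: c_mult) (simp add: c_def vec_eq_iff)
    ultimately show "(\<lambda>k. c (z (Suc k)) - map_matrix complex_of_real A *v c (z k)) \<longlonglongrightarrow> 0"
      by simp
  qed (simp_all add: p(2))
  then have "(\<lambda>k. Re (c (z k) $ i)) \<longlonglongrightarrow> Re (0 $ i)" for i
    by (intro tendsto_Re tendsto_vec_nth)
  then show ?thesis by (intro vec_tendstoI) (simp add: c_def)
qed

text \<open>The limit can only be the fixed point \<open>(I - A)\<^sup>-\<^sup>1 \<beta>\<close>.
  The distance to it obeys the homogeneous recursion up to \<open>b k - \<beta>\<close>, which
  vanishes in the limit.\<close>

lemma stable_recursion_tendsto: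
  fixes A :: "real^'d::finite^'d" and z :: "nat \<Rightarrow> real^'d"
  assumes inv: "\<And>l. 1 \<le> cmod l \<Longrightarrow> \<exists>B. B ** (map_matrix complex_of_real A - mat l) = mat 1"
    and "invertible (mat 1 - A)"
    and rec: "\<And>k. z (Suc k) = A *v z k + b k" and b: "b \<longlonglongrightarrow> \<beta>"
  obtains L where "z \<longlonglongrightarrow> L" "L = A *v L + \<beta>"
proof
  define L where "L = matrix_inv (mat 1 - A) *v \<beta>"
  have "(mat 1 - A) *v L = \<beta>"
    using assms(2) by (simp add: L_def matrix_vector_mul_assoc matrix_inv_inverse)
  then show L: "L = A *v L + \<beta>"
    by (simp add: matrix_vector_mult_diff_rdistrib algebra_simps)
  have "(\<lambda>k. z k - L) \<longlonglongrightarrow> 0"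
  proof (rule stable_recursion_tendsto_zero[OF inv])
    have "(z (Suc k) - L) - A *v (z k - L) = b k - \<beta>" for k
      using L by (simp add: rec matrix_vector_mult_diff_distrib algebra_simps)
    then show "(\<lambda>k. (z (Suc k) - L) - A *v (z k - L)) \<longlonglongrightarrow> 0"
      using b by (simp add: LIM_zero)
  qed
  then show "z \<longlonglongrightarrow> L" by (rule LIM_zero_cancel)
qed

section \<open>Affine recursions with i.i.d. coefficients\<close>

text \<open>The recursion is solved along a deterministic sample path first. Its value at
  \<open>i\<close> depends only on the coordinates below \<open>i\<close>, which later gives
  independence of the current sample.\<close>

primrec affine_path ::
    "('y \<Rightarrow> real^'d^'d) \<Rightarrow> ('y \<Rightarrow> real^'d) \<Rightarrow> real^'d \<Rightarrow> (nat \<Rightarrow> 'y) \<Rightarrow> nat \<Rightarrow> real^'d"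
  where
    "affine_path A v x y 0 = x"
  | "affine_path A v x y (Suc i) = A (y i) *v affine_path A v x y i + v (y i)"

lemma affine_path_cong:
  "(\<And>j. j < i \<Longrightarrow> y j = y' j) \<Longrightarrow> affine_path A v x y i = affine_path A v x y' i"
  by (induction i) auto

text \<open>Finiteness of the type \<open>'y\<close> makes every function of a sample bounded, hence
  integrable.\<close>

locale iid_affine_recursion = prob_space M for M :: "'w measure" +
  fixes Y :: "nat \<Rightarrow> 'w \<Rightarrow> 'y::finite"
    and A :: "'y \<Rightarrow> real^'d::finite^'d" and v :: "'y \<Rightarrow> real^'d" and x0 :: "real^'d"
  assumes indep: "indep_vars (\<lambda>_. count_space UNIV) Y UNIV"
    and ident: "\<And>i. distr M (count_space UNIV) (Y i) = distr M (count_space UNIV) (Y 0)"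
begin

definition e :: "nat \<Rightarrow> 'w \<Rightarrow> real^'d"
  where "e i \<omega> = affine_path A v x0 (\<lambda>j. Y j \<omega>) i"

definition expect :: "('y \<Rightarrow> real) \<Rightarrow> real"
  where "expect f = (\<integral>\<omega>. f (Y 0 \<omega>) \<partial>M)"

lemma measurable_Y [measurable]: "Y i \<in> measurable M (count_space UNIV)"
  using indep unfolding indep_vars_def by auto

lemma measurable_fun_Y: "(\<lambda>\<omega>. f (Y i \<omega>)) \<in> measurable M N" if "range f \<subseteq> space N"
proof -
  have "f \<in> measurable (count_space UNIV) N" using that by (intro measurable_count_space_eq1[THEN iffD2]) auto
  then show ?thesis by (rule measurable_compose[OF measurable_Y])
qed

lemma integrable_fun_Y:
  fixes f :: "'y \<Rightarrow> 'b::{banach, second_countable_topology}"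
  shows "integrable M (\<lambda>\<omega>. f (Y i \<omega>))"
proof (rule integrable_const_bound)
  show "AE \<omega> in M. norm (f (Y i \<omega>)) \<le> Max (range (\<lambda>y. norm (f y)))"
    by (intro AE_I2 Max_ge) auto
qed (rule measurable_fun_Y, simp)

lemma integral_fun_Y: "(\<integral>\<omega>. f (Y i \<omega>) \<partial>M) = expect f" for f :: "'y \<Rightarrow> real"
proof -
  have "(\<integral>\<omega>. f (Y i \<omega>) \<partial>M) = (\<integral>y. f y \<partial>distr M (count_space UNIV) (Y i))" for i
    by (subst integral_distr) (use measurable_Y in auto)
  then show ?thesis unfolding expect_def using ident by metis
qed

lemma e_0 [simp]: "e 0 \<omega> = x0"
  and e_Suc: "e (Suc i) \<omega> = A (Y i \<omega>) *v e i \<omega> + v (Y i \<omega>)"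
  by (simp_all add: e_def)

lemma e_eq_affine_path_restrict:
  "e i \<omega> = affine_path A v x0 (restrict (\<lambda>j. Y j \<omega>) {..<i}) i"
  unfolding e_def by (rule affine_path_cong) simp

lemma count_space_paths:
  "finite J \<Longrightarrow> PiM J (\<lambda>_. count_space UNIV) = count_space (PiE J (\<lambda>_. UNIV :: 'y set))"
  for J :: "nat set"
  by (rule count_space_PiM_finite) auto

lemma measurable_e [measurable]: "e i \<in> borel_measurable M"
proof -
  have "(\<lambda>\<omega>. restrict (\<lambda>j. Y j \<omega>) {..<i}) \<in> measurable M (PiM {..<i} (\<lambda>_. count_space UNIV))"
    by (rule measurable_restrict) simp
  then have "(\<lambda>\<omega>. affine_path A v x0 (restrict (\<lambda>j. Y j \<omega>) {..<i}) i) \<in> borel_measurable M"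
    by (rule measurable_compose) (simp add: count_space_paths)
  then show ?thesis by (simp add: e_eq_affine_path_restrict[abs_def])
qed

text \<open>The error at time \<open>i\<close> is a function of the samples with index below
  \<open>i\<close>, a block of indices disjoint from \<open>{i}\<close>.\<close>

lemma indep_Y_e:
  fixes f :: "'y \<Rightarrow> real" and g :: "real^'d \<Rightarrow> real"
  shows "indep_var borel (\<lambda>\<omega>. f (Y i \<omega>)) borel (\<lambda>\<omega>. g (e i \<omega>))"
proof -
  have "indep_var (PiM {i} (\<lambda>_. count_space UNIV)) (\<lambda>\<omega>. restrict (\<lambda>j. Y j \<omega>) {i})
      (PiM {..<i} (\<lambda>_. count_space UNIV)) (\<lambda>\<omega>. restrict (\<lambda>j. Y j \<omega>) {..<i})"
    by (rule indep_var_restrict[OF indep]) auto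
  then have "indep_var borel ((\<lambda>y. f (y i)) \<circ> (\<lambda>\<omega>. restrict (\<lambda>j. Y j \<omega>) {i}))
      borel ((\<lambda>y. g (affine_path A v x0 y i)) \<circ> (\<lambda>\<omega>. restrict (\<lambda>j. Y j \<omega>) {..<i}))"
    by (rule indep_var_compose) (simp_all add: count_space_paths)
  then show ?thesis by (simp add: o_def e_eq_affine_path_restrict)
qed

text \<open>One step scales the norm by at most the largest operator norm of the finitely many
  \<open>A y\<close> and adds at most the largest \<open>norm (v y)\<close>. The bound may grow with
  \<open>i\<close>; it serves only for integrability.\<close>

lemma e_bounded: "\<exists>B. \<forall>\<omega>. norm (e i \<omega>) \<le> B"
proof (induction i)
  case (Suc i)
  then obtain B where B: "\<And>\<omega>. norm (e i \<omega>) \<le> B" by blast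
  define a where "a = Max (range (\<lambda>y. onorm ((*v) (A y))))"
  define b where "b = Max (range (\<lambda>y. norm (v y)))"
  have a: "onorm ((*v) (A y)) \<le> a" for y unfolding a_def by (intro Max_ge) auto
  have b: "norm (v y) \<le> b" for y unfolding b_def by (intro Max_ge) auto
  have bl: "bounded_linear ((*v) (A y))" for y by simp
  have "norm (e (Suc i) \<omega>) \<le> a * B + b" for \<omega>
  proof -
    have "norm (A (Y i \<omega>) *v e i \<omega>) \<le> onorm ((*v) (A (Y i \<omega>))) * norm (e i \<omega>)"
      by (rule onorm[OF bl])
    also have "\<dots> \<le> a * B"
      using order_trans[OF onorm_pos_le[OF bl] a] by (intro mult_mono a B) auto
    finally show ?thesis unfolding e_Suc
      using norm_triangle_ineq[of "A (Y i \<omega>) *v e i \<omega>" "v (Y i \<omega>)"] b[of "Y i \<omega>"] by linarith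
  qed
  then show ?case by blast
qed auto

lemma integrable_e: "integrable M (e i)"
  using e_bounded[of i] by (auto intro!: integrable_const_bound)

lemma integrable_e_nth [simp]: "integrable M (\<lambda>\<omega>. e i \<omega> $ p)"
  by (rule integrable_bounded_linear[OF bounded_linear_vec_nth integrable_e])

lemma integrable_e_nth_mult [simp]: "integrable M (\<lambda>\<omega>. e i \<omega> $ p * e i \<omega> $ q)"
proof -
  obtain B where B: "\<And>\<omega>. norm (e i \<omega>) \<le> B" using e_bounded by blast
  show ?thesis
  proof (rule integrable_const_bound)
    show "AE \<omega> in M. norm (e i \<omega> $ p * e i \<omega> $ q) \<le> B * B"
      unfolding norm_mult
      using B order_trans[OF Finite_Cartesian_Product.norm_nth_le B] order_trans[OF norm_ge_zero B]
      by (intro AE_I2 mult_mono) auto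
  qed (intro borel_measurable_times borel_measurable_integrable[OF integrable_e_nth])
qed

lemma
  fixes f :: "'y \<Rightarrow> real" and g :: "real^'d \<Rightarrow> real"
  assumes g: "integrable M (\<lambda>\<omega>. g (e i \<omega>))"
  shows integrable_Y_e: "integrable M (\<lambda>\<omega>. f (Y i \<omega>) * g (e i \<omega>))"
    and integral_Y_e: "(\<integral>\<omega>. f (Y i \<omega>) * g (e i \<omega>) \<partial>M) = expect f * (\<integral>\<omega>. g (e i \<omega>) \<partial>M)"
proof -
  show "integrable M (\<lambda>\<omega>. f (Y i \<omega>) * g (e i \<omega>))"
    by (rule indep_var_integrable[OF indep_Y_e integrable_fun_Y g])
  show "(\<integral>\<omega>. f (Y i \<omega>) * g (e i \<omega>) \<partial>M) = expect f * (\<integral>\<omega>. g (e i \<omega>) \<partial>M)"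
    using indep_var_lebesgue_integral[OF indep_Y_e integrable_fun_Y g, of f] by (simp add: integral_fun_Y)
qed

lemma expect_add: "expect (\<lambda>y. f y + g y) = expect f + expect g"
  and expect_diff: "expect (\<lambda>y. f y - g y) = expect f - expect g"
  and expect_mult_left: "expect (\<lambda>y. c * f y) = c * expect f"
  and expect_mult_right: "expect (\<lambda>y. f y * c) = expect f * c"
  and expect_sum: "expect (\<lambda>y. \<Sum>i\<in>I. F i y) = (\<Sum>i\<in>I. expect (F i))"
  and expect_const: "expect (\<lambda>y. c) = c"
  by (simp_all add: expect_def integrable_fun_Y prob_space)

lemma integral_fun_Y_nth:
  fixes f :: "'y \<Rightarrow> real^'i"
  shows "(\<integral>\<omega>. f (Y 0 \<omega>) \<partial>M) $ p = expect (\<lambda>y. f y $ p)"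
  unfolding expect_def
  by (rule integral_bounded_linear[OF bounded_linear_vec_nth integrable_fun_Y, symmetric])

lemma integral_fun_Y_nth_nth:
  fixes f :: "'y \<Rightarrow> real^'j^'i"
  shows "(\<integral>\<omega>. f (Y 0 \<omega>) \<partial>M) $ p $ q = expect (\<lambda>y. f y $ p $ q)"
proof -
  have "(\<integral>\<omega>. f (Y 0 \<omega>) \<partial>M) $ p = (\<integral>\<omega>. f (Y 0 \<omega>) $ p \<partial>M)"
    by (rule integral_bounded_linear[OF bounded_linear_vec_nth integrable_fun_Y, symmetric])
  then show ?thesis by (simp add: integral_fun_Y_nth[where f = "\<lambda>y. f y $ p"])
qed

section \<open>First and second moments of the error\<close>

definition mean :: "nat \<Rightarrow> real^'d"
  where "mean i = (\<integral>\<omega>. e i \<omega> \<partial>M)"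

definition second :: "nat \<Rightarrow> real^('d \<times> 'd)"
  where "second i = (\<chi> p. \<integral>\<omega>. e i \<omega> $ fst p * e i \<omega> $ snd p \<partial>M)"

definition A_mean :: "real^'d^'d"
  where "A_mean = (\<chi> p q. expect (\<lambda>y. A y $ p $ q))"

text \<open>\<open>K\<close> is the mean of \<open>transpose A \<otimes> transpose A\<close>, so it
  maps \<open>vec_cols \<Sigma>\<close> to the vectorised mean of
  \<open>transpose A ** \<Sigma> ** A\<close>. In the same notation \<open>U\<close> is the mean of
  \<open>v \<otimes> A\<close> and \<open>h\<close> that of \<open>v \<otimes> v\<close>.\<close>

definition K :: "real^('d \<times> 'd)^('d \<times> 'd)"
  where "K = (\<chi> p q. expect (\<lambda>y. A y $ fst q $ fst p * A y $ snd q $ snd p))"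

definition U :: "real^'d^('d \<times> 'd)"
  where "U = (\<chi> p j. expect (\<lambda>y. v y $ fst p * A y $ snd p $ j))"

definition h :: "real^('d \<times> 'd)"
  where "h = (\<chi> p. expect (\<lambda>y. v y $ fst p * v y $ snd p))"

lemma mean_nth: "mean i $ p = (\<integral>\<omega>. e i \<omega> $ p \<partial>M)"
  unfolding mean_def
  by (rule integral_bounded_linear[OF bounded_linear_vec_nth integrable_e, symmetric])

lemma mean_Suc: "mean (Suc i) = A_mean *v mean i + (\<chi> p. expect (\<lambda>y. v y $ p))"
proof (unfold vec_eq_iff, intro allI)
  fix p
  have "mean (Suc i) $ p
      = (\<integral>\<omega>. (\<Sum>q\<in>UNIV. A (Y i \<omega>) $ p $ q * e i \<omega> $ q) + v (Y i \<omega>) $ p \<partial>M)"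
    by (simp add: mean_nth e_Suc matrix_vector_mult_def)
  also have "\<dots> = (\<Sum>q\<in>UNIV. \<integral>\<omega>. A (Y i \<omega>) $ p $ q * e i \<omega> $ q \<partial>M) + (\<integral>\<omega>. v (Y i \<omega>) $ p \<partial>M)"
    by (subst Bochner_Integration.integral_add)
      (auto intro!: integrable_fun_Y[where f = "\<lambda>y. v y $ p"] Bochner_Integration.integrable_sum
        integrable_Y_e[where g = "\<lambda>x. x $ q" and f = "\<lambda>y. A y $ p $ q" for q]
        Bochner_Integration.integral_sum)
  also have "\<dots> = (\<Sum>q\<in>UNIV. expect (\<lambda>y. A y $ p $ q) * mean i $ q) + expect (\<lambda>y. v y $ p)"
    by (simp add: integral_fun_Y[where f = "\<lambda>y. v y $ p"] mean_nth
        integral_Y_e[where g = "\<lambda>x. x $ q" and f = "\<lambda>y. A y $ p $ q" for q])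
  finally show "mean (Suc i) $ p = (A_mean *v mean i + (\<chi> p. expect (\<lambda>y. v y $ p))) $ p"
    by (simp add: A_mean_def matrix_vector_mult_def)
qed

text \<open>Expand \<open>(A e + v) \<otimes> (A e + v)\<close> and factor each expectation by
  independence of \<open>A\<close>, \<open>v\<close> from \<open>e\<close>. The two cross terms are
  \<open>U *v mean i\<close> and its copy with the tensor factors exchanged. The transpose appears
  because \<open>K\<close> acts on weights and not on moments.\<close>

lemma second_Suc:
  "second (Suc i) = transpose K *v second i
    + (h + U *v mean i + (\<chi> p. (U *v mean i) $ (snd p, fst p)))"
proof (unfold vec_eq_iff, intro allI)
  fix pq :: "'d \<times> 'd"
  obtain p q where pq: "pq = (p, q)" by (cases pq)
  let ?A = "\<lambda>\<omega>. A (Y i \<omega>)" and ?v = "\<lambda>\<omega>. v (Y i \<omega>)"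
  \<comment> \<open>The facts \<open>m2\<close>, \<open>m1\<close> and \<open>m0\<close> factor the
    terms of degree two, one and zero in the error.\<close>
  have m2: "has_bochner_integral M (\<lambda>\<omega>. f (Y i \<omega>) * (e i \<omega> $ p * e i \<omega> $ q))
      (expect f * second i $ (p, q))" for f p q
    by (auto simp: has_bochner_integral_iff second_def
        intro!: integrable_Y_e[where g = "\<lambda>x. x $ p * x $ q"] integral_Y_e[where g = "\<lambda>x. x $ p * x $ q"])
  have m1: "has_bochner_integral M (\<lambda>\<omega>. f (Y i \<omega>) * e i \<omega> $ p) (expect f * mean i $ p)" for f p
    by (auto simp: has_bochner_integral_iff mean_nth
        intro!: integrable_Y_e[where g = "\<lambda>x. x $ p"] integral_Y_e[where g = "\<lambda>x. x $ p"])
  have m0: "has_bochner_integral M (\<lambda>\<omega>. f (Y i \<omega>)) (expect f)" for f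
    by (simp add: has_bochner_integral_iff integrable_fun_Y integral_fun_Y)
  have "has_bochner_integral M (\<lambda>\<omega>.
      (\<Sum>r\<in>UNIV. \<Sum>s\<in>UNIV. ?A \<omega> $ p $ r * ?A \<omega> $ q $ s * (e i \<omega> $ r * e i \<omega> $ s))
      + (?v \<omega> $ p * ?v \<omega> $ q + (\<Sum>s\<in>UNIV. ?v \<omega> $ p * ?A \<omega> $ q $ s * e i \<omega> $ s)
        + (\<Sum>r\<in>UNIV. ?v \<omega> $ q * ?A \<omega> $ p $ r * e i \<omega> $ r)))
      ((\<Sum>r\<in>UNIV. \<Sum>s\<in>UNIV. expect (\<lambda>y. A y $ p $ r * A y $ q $ s) * second i $ (r, s))
      + (expect (\<lambda>y. v y $ p * v y $ q) + (\<Sum>s\<in>UNIV. expect (\<lambda>y. v y $ p * A y $ q $ s) * mean i $ s)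
        + (\<Sum>r\<in>UNIV. expect (\<lambda>y. v y $ q * A y $ p $ r) * mean i $ r)))"
    by (intro has_bochner_integral_add has_bochner_integral_sum
        m2[of "\<lambda>y. A y $ p $ r * A y $ q $ s" for r s] m0[of "\<lambda>y. v y $ p * v y $ q"]
        m1[of "\<lambda>y. v y $ p * A y $ q $ s" for s] m1[of "\<lambda>y. v y $ q * A y $ p $ s" for s])
  moreover have "e (Suc i) \<omega> $ p * e (Suc i) \<omega> $ q
      = (\<Sum>r\<in>UNIV. \<Sum>s\<in>UNIV. ?A \<omega> $ p $ r * ?A \<omega> $ q $ s * (e i \<omega> $ r * e i \<omega> $ s))
      + (?v \<omega> $ p * ?v \<omega> $ q + (\<Sum>s\<in>UNIV. ?v \<omega> $ p * ?A \<omega> $ q $ s * e i \<omega> $ s)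
        + (\<Sum>r\<in>UNIV. ?v \<omega> $ q * ?A \<omega> $ p $ r * e i \<omega> $ r))" for \<omega>
  proof -
    have "(\<Sum>r\<in>UNIV. \<Sum>s\<in>UNIV. ?A \<omega> $ p $ r * ?A \<omega> $ q $ s * (e i \<omega> $ r * e i \<omega> $ s))
        = (?A \<omega> *v e i \<omega>) $ p * (?A \<omega> *v e i \<omega>) $ q"
      by (simp add: matrix_vector_mult_def sum_product mult_ac)
    moreover have "(\<Sum>s\<in>UNIV. ?v \<omega> $ p' * ?A \<omega> $ q' $ s * e i \<omega> $ s) = ?v \<omega> $ p' * (?A \<omega> *v e i \<omega>) $ q'"
      for p' q'
      by (simp add: matrix_vector_mult_def sum_distrib_left mult_ac)
    ultimately show ?thesis by (simp add: e_Suc algebra_simps)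
  qed
  ultimately have "second (Suc i) $ (p, q)
      = (\<Sum>r\<in>UNIV. \<Sum>s\<in>UNIV. expect (\<lambda>y. A y $ p $ r * A y $ q $ s) * second i $ (r, s))
      + (expect (\<lambda>y. v y $ p * v y $ q) + (\<Sum>s\<in>UNIV. expect (\<lambda>y. v y $ p * A y $ q $ s) * mean i $ s)
        + (\<Sum>r\<in>UNIV. expect (\<lambda>y. v y $ q * A y $ p $ r) * mean i $ r))"
    unfolding second_def by (simp add: has_bochner_integral_integral_eq)
  moreover have "(transpose K *v second i) $ (p, q)
      = (\<Sum>r\<in>UNIV. \<Sum>s\<in>UNIV. expect (\<lambda>y. A y $ p $ r * A y $ q $ s) * second i $ (r, s))"
    by (simp add: matrix_vector_mult_def transpose_def K_def sum.cartesian_product case_prod_beta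
        UNIV_Times_UNIV[symmetric] del: UNIV_Times_UNIV)
  ultimately show "second (Suc i) $ pq = (transpose K *v second i
    + (h + U *v mean i + (\<chi> p. (U *v mean i) $ (snd p, fst p)))) $ pq"
    by (simp add: pq h_def U_def matrix_vector_mult_def)
qed

text \<open>A quadratic form is a linear functional of the second moment. The transpose reconciles
  column stacking with the index order in \<open>second\<close>.\<close>

lemma integral_quadratic_form:
  "(\<integral>\<omega>. e i \<omega> \<bullet> (\<Sigma> *v e i \<omega>) \<partial>M) = second i \<bullet> vec_cols (transpose \<Sigma>)"
proof -
  have "e i \<omega> \<bullet> (\<Sigma> *v e i \<omega>) = (\<Sum>p\<in>UNIV. \<Sum>q\<in>UNIV. \<Sigma> $ p $ q * (e i \<omega> $ p * e i \<omega> $ q))" for \<omega>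
    by (simp add: inner_vec_def matrix_vector_mult_def sum_distrib_left mult_ac)
  then have "(\<integral>\<omega>. e i \<omega> \<bullet> (\<Sigma> *v e i \<omega>) \<partial>M)
      = (\<Sum>p\<in>UNIV. \<Sum>q\<in>UNIV. \<Sigma> $ p $ q * second i $ (p, q))"
    by (simp add: second_def Bochner_Integration.integral_sum)
  then show ?thesis
    by (simp add: inner_vec_def vec_cols_def transpose_def sum.cartesian_product case_prod_beta mult.commute
        UNIV_Times_UNIV[symmetric] del: UNIV_Times_UNIV)
qed

section \<open>Exchange of the tensor factors and the limit of quadratic forms\<close>

definition swap :: "real^('d \<times> 'd) \<Rightarrow> real^('d \<times> 'd)"
  where "swap x = (\<chi> p. x $ prod.swap p)"

lemma sum_prod_swap: "(\<Sum>p\<in>UNIV. f (prod.swap p)) = (\<Sum>p\<in>UNIV. f p)"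
  for f :: "'d \<times> 'd \<Rightarrow> 'b::comm_monoid_add"
  by (rule sum.reindex_bij_betw) (rule bij_swap)

lemma inner_swap: "swap x \<bullet> y = x \<bullet> swap y"
  using sum_prod_swap[of "\<lambda>p. x $ p * y $ prod.swap p"] by (simp add: inner_vec_def swap_def)

text \<open>Both tensor factors of \<open>K\<close> are built from the same random matrix, so
  exchanging them leaves its entries unchanged.\<close>

lemma K_swap: "K *v swap x = swap (K *v x)"
proof -
  have "K $ prod.swap p $ prod.swap q = K $ p $ q" for p q
    by (simp add: K_def mult.commute)
  then show ?thesis
    using sum_prod_swap[of "\<lambda>q. K $ prod.swap p $ q * x $ q" for p]
    by (simp add: vec_eq_iff matrix_vector_mult_def swap_def)
qed

text \<open>
  Since \<open>K\<close> commutes with \<open>swap\<close>, the vector \<open>y = (I - K)\<^sup>-\<^sup>1 vec \<Sigma>\<close> is symmetric along with \<open>\<Sigma>\<close>. It therefore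
  does not tell apart the two cross terms in \<open>second_Suc\<close>, and this is where the factor 2 comes from.
\<close>

theorem
  assumes stable: "spec_radius A_mean < 1" and square_stable: "spec_radius K < 1"
  shows convergent_mean: "convergent mean"
    and quadratic_form_limit: "transpose \<Sigma> = \<Sigma> \<Longrightarrow>
      (\<lambda>i. \<integral>\<omega>. e i \<omega> \<bullet> (\<Sigma> *v e i \<omega>) \<partial>M)
        \<longlonglongrightarrow> (h + 2 *\<^sub>R (U *v lim mean)) \<bullet> (matrix_inv (mat 1 - K) *v vec_cols \<Sigma>)"
proof -
  obtain m where m: "mean \<longlonglongrightarrow> m"
    by (rule stable_recursion_tendsto[OF left_inverse_outside_spec_radius[OF stable]
        invertible_mat_1_minus[OF stable], where z = mean
          and b = "\<lambda>_. \<chi> p. expect (\<lambda>y. v y $ p)" and \<beta> = "\<chi> p. expect (\<lambda>y. v y $ p)"])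
      (assumption, rule mean_Suc, rule tendsto_const, blast)
  then show "convergent mean" by (rule convergentI)
  have lim: "lim mean = m" using m by (rule limI)
  have second_rec: "second (Suc i) = transpose K *v second i + (h + U *v mean i + swap (U *v mean i))" for i
    by (simp add: second_Suc swap_def prod.swap_def)
  have tendsto_swap: "(\<lambda>i. swap (f i)) \<longlonglongrightarrow> swap l" if "f \<longlonglongrightarrow> l" for f l
    unfolding swap_def using tendsto_vec_nth[OF that] by (intro vec_tendstoI) simp
  have b: "(\<lambda>i. h + U *v mean i + swap (U *v mean i)) \<longlonglongrightarrow> h + U *v m + swap (U *v m)"
    by (intro tendsto_add tendsto_const tendsto_swap tendsto_matrix_vector_mult m)
  obtain L where L: "second \<longlonglongrightarrow> L" "L = transpose K *v L + (h + U *v m + swap (U *v m))"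
    by (rule stable_recursion_tendsto[OF left_inverse_outside_spec_radius_transpose[OF square_stable]
        invertible_mat_1_minus_transpose[OF square_stable], OF _ second_rec b])
      (assumption, blast)
  assume \<Sigma>: "transpose \<Sigma> = \<Sigma>"
  note inv = matrix_inv_inverse[OF invertible_mat_1_minus[OF square_stable]]
  define y where "y = matrix_inv (mat 1 - K) *v vec_cols \<Sigma>"
  have y: "(mat 1 - K) *v y = vec_cols \<Sigma>"
    by (simp add: y_def matrix_vector_mul_assoc inv)
  have "\<Sigma> $ p $ q = \<Sigma> $ q $ p" for p q
    using \<Sigma> by (metis transpose_def vec_lambda_beta)
  then have "swap (vec_cols \<Sigma>) = vec_cols \<Sigma>"
    by (simp add: swap_def vec_cols_def vec_eq_iff)
  moreover have "(mat 1 - K) *v swap y = swap ((mat 1 - K) *v y)"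
    by (simp add: matrix_vector_mult_diff_rdistrib K_swap) (simp add: swap_def vec_eq_iff)
  ultimately have "(mat 1 - K) *v swap y = vec_cols \<Sigma>" by (simp add: y)
  \<comment> \<open>Both \<open>y\<close> and \<open>swap y\<close> solve the same equation with the
    invertible matrix \<open>mat 1 - K\<close>.\<close>
  then have swap_y: "swap y = y"
    unfolding y_def by (metis inv(2) matrix_vector_mul_assoc matrix_vector_mul_lid)
  \<comment> \<open>Moving \<open>mat 1 - K\<close> from \<open>y\<close> to \<open>L\<close>
    replaces it by its transpose, and the limit equation evaluates that without solving for
    \<open>L\<close>.\<close>
  have "L \<bullet> vec_cols \<Sigma> = L \<bullet> y - L \<bullet> (K *v y)"
    by (simp flip: y add: matrix_vector_mult_diff_rdistrib inner_diff_right)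
  also have "\<dots> = (L - transpose K *v L) \<bullet> y"
    using vector_transpose_matrix[of L "transpose K"]
    by (simp add: inner_diff_left dot_lmul_matrix[symmetric])
  also have "L - transpose K *v L = h + U *v m + swap (U *v m)"
    using L(2) by (simp add: algebra_simps)
  also have "\<dots> \<bullet> y = (h + 2 *\<^sub>R (U *v m)) \<bullet> y"
    by (simp add: inner_add_left inner_swap swap_y)
  finally have "L \<bullet> vec_cols \<Sigma> = (h + 2 *\<^sub>R (U *v lim mean)) \<bullet> y" by (simp add: lim)
  moreover have "(\<lambda>i. second i \<bullet> vec_cols \<Sigma>) \<longlonglongrightarrow> L \<bullet> vec_cols \<Sigma>"
    by (intro tendsto_inner L tendsto_const)
  ultimately show "(\<lambda>i. \<integral>\<omega>. e i \<omega> \<bullet> (\<Sigma> *v e i \<omega>) \<partial>M)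
        \<longlonglongrightarrow> (h + 2 *\<^sub>R (U *v lim mean)) \<bullet> (matrix_inv (mat 1 - K) *v vec_cols \<Sigma>)"
    by (simp add: integral_quadratic_form \<Sigma> y_def)
qed

end

section \<open>The diffusion algorithm\<close>

lemma transpose_kron_mat_1_mult_col_stack:
  fixes C :: "real^'n::finite^'n" and x :: "'n \<Rightarrow> real^'b::finite"
  shows "transpose (kron C (mat 1)) *v col_stack x = col_stack (\<lambda>k. \<Sum>l\<in>UNIV. C $ l $ k *\<^sub>R x l)"
proof (unfold vec_eq_iff, intro allI)
  fix p :: "'n \<times> 'b"
  have "(transpose (kron C (mat 1)) *v col_stack x) $ p
      = (\<Sum>q\<in>UNIV \<times> UNIV. C $ fst q $ fst p * (if snd q = snd p then 1 else 0) * x (fst q) $ snd q)"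
    by (simp add: matrix_vector_mult_def transpose_def kron_def col_stack_def mat_def)
  also have "\<dots> = (\<Sum>l\<in>UNIV. \<Sum>j\<in>UNIV. C $ l $ fst p * (if j = snd p then 1 else 0) * x l $ j)"
    by (simp only: sum.cartesian_product case_prod_unfold)
  also have "\<dots> = (\<Sum>l\<in>UNIV. C $ l $ fst p * x l $ snd p)"
    by (simp add: if_distrib if_distribR cong: if_cong)
  finally show "(transpose (kron C (mat 1)) *v col_stack x) $ p
      = col_stack (\<lambda>k. \<Sum>l\<in>UNIV. C $ l $ k *\<^sub>R x l) $ p"
    by (simp add: col_stack_def)
qed

lemma block_diag_mult_col_stack:
  fixes B :: "'n::finite \<Rightarrow> real^'b::finite^'b"
  shows "block_diag B *v col_stack x = col_stack (\<lambda>k. B k *v x k)"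
proof (unfold vec_eq_iff, intro allI)
  fix p :: "'n \<times> 'b"
  have "(block_diag B *v col_stack x) $ p
      = (\<Sum>q\<in>UNIV \<times> UNIV. (if fst p = fst q then B (fst p) $ snd p $ snd q else 0) * x (fst q) $ snd q)"
    by (simp add: matrix_vector_mult_def block_diag_def col_stack_def)
  also have "\<dots> = (\<Sum>l\<in>UNIV. \<Sum>j\<in>UNIV. (if fst p = l then B (fst p) $ snd p $ j else 0) * x l $ j)"
    by (simp only: sum.cartesian_product case_prod_unfold)
  also have "\<dots> = (\<Sum>l\<in>UNIV. if fst p = l then (\<Sum>j\<in>UNIV. B (fst p) $ snd p $ j * x l $ j) else 0)"
    by (intro sum.cong) auto
  finally show "(block_diag B *v col_stack x) $ p = col_stack (\<lambda>k. B k *v x k) $ p"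
    by (simp add: col_stack_def matrix_vector_mult_def)
qed

lemma col_stack_mult_vec: "col_stack B *v a = col_stack (\<lambda>k. B k *v a)"
  for B :: "'n::finite \<Rightarrow> real^'c::finite^'b"
  by (simp add: vec_eq_iff col_stack_def matrix_vector_mult_def)

lemma col_stack_add: "col_stack x + col_stack y = col_stack (\<lambda>k. x k + y k)"
  and col_stack_diff: "col_stack x - col_stack y = col_stack (\<lambda>k. x k - y k)"
  and col_stack_scaleR: "c *\<^sub>R col_stack x = col_stack (\<lambda>k. c *\<^sub>R x k)"
  for x y :: "'n::finite \<Rightarrow> real^'b"
  by (simp_all add: col_stack_def vec_eq_iff)

lemma outer_matrix_vector_mult: "outer (B *v x) (B *v x) = B ** outer x x ** transpose B"
  for B :: "real^'c::finite^'r"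
proof (unfold vec_eq_iff, intro allI)
  fix i j
  have "(B ** outer x x ** transpose B) $ i $ j = (\<Sum>s\<in>UNIV. (B *v x) $ i * (B $ j $ s * x $ s))"
    unfolding matrix_matrix_mult_def outer_def transpose_def matrix_vector_mult_def
    by (auto intro!: sum.cong simp: sum_distrib_left sum_distrib_right mult_ac)
  then show "outer (B *v x) (B *v x) $ i $ j = (B ** outer x x ** transpose B) $ i $ j"
    by (simp add: outer_def matrix_vector_mult_def flip: sum_distrib_left)
qed

lemma transpose_J_mat: "transpose (J_mat k) = J_mat k"
  by (simp add: J_mat_def transpose_def block_diag_def vec_eq_iff mat_def)

lemma sum_J_mat: "(\<Sum>k\<in>UNIV. J_mat k) = mat 1"
proof (unfold vec_eq_iff, intro allI)
  fix p q :: "'a \<times> 'b"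
  have "J_mat k $ p $ q = (if fst p = k then mat 1 $ p $ q else 0)" for k
    by (simp add: J_mat_def block_diag_def mat_def prod_eq_iff)
  then show "(\<Sum>k\<in>UNIV. J_mat k) $ p $ q = mat 1 $ p $ q" by simp
qed

lemma vec_cols_sum: "vec_cols (\<Sum>k\<in>I. B k) = (\<Sum>k\<in>I. vec_cols (B k))"
  by (simp add: vec_cols_def vec_eq_iff)

text \<open>This makes the squared error of one agent an instance of the weighted network
  error.\<close>

lemma J_mat_quadratic_form:
  fixes x :: "'n::finite \<Rightarrow> real^'b::finite"
  shows "col_stack x \<bullet> (J_mat k *v col_stack x) = (norm (x k))\<^sup>2"
proof -
  have "col_stack x \<bullet> col_stack y = (\<Sum>l\<in>UNIV. x l \<bullet> y l)" for y :: "'n \<Rightarrow> real^'b"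
    unfolding inner_vec_def col_stack_def UNIV_Times_UNIV[symmetric] sum.cartesian_product
    by (simp add: case_prod_beta)
  moreover have "x l \<bullet> ((if l = k then mat 1 else 0) *v x l) = (if l = k then x l \<bullet> x l else 0)" for l
    by simp
  ultimately show ?thesis
    by (simp add: J_mat_def block_diag_mult_col_stack power2_norm_eq_inner)
qed

text \<open>
  The same data with the sample space replaced by the finite set of joint samples of all agents, so
  that every random quantity built from one sample is a function on that set.
\<close>

definition sample_setting ::
    "('s::finite, 'a::finite, 'm::finite, 'n::finite, 'w) gtd \<Rightarrow> ('s, 'a, 'm, 'n, 'n \<Rightarrow> 's \<times> 'a \<times> 's) gtd"
  where "sample_setting S = \<lparr>kernel = kernel S, reward = reward S, discount = discount S,
    target = target S, features = features S, behavior = behavior S, stat_dist = stat_dist S,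
    combination = combination S, weights = weights S, eta = eta S, step_size = step_size S,
    init = init S, prob_sp = count_space UNIV, state = (\<lambda>k i y. fst (y k)),
    act = (\<lambda>k i y. fst (snd (y k))), next_state = (\<lambda>k i y. snd (snd (y k)))\<rparr>"

definition joint_sample :: "('s::finite, 'a::finite, 'm::finite, 'n::finite, 'w) gtd \<Rightarrow> nat \<Rightarrow> 'w \<Rightarrow> 'n \<Rightarrow> 's \<times> 'a \<times> 's"
  where "joint_sample S i \<omega> k = (state S k i \<omega>, act S k i \<omega>, next_state S k i \<omega>)"

definition R_sample ::
    "('s::finite, 'a::finite, 'm::finite, 'n::finite, 'w) gtd \<Rightarrow> ('n \<Rightarrow> 's \<times> 'a \<times> 's) \<Rightarrow>
      real^('n \<times> ('m + 'm))^('n \<times> ('m + 'm))"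
  where "R_sample S y = R_mat (sample_setting S) 0 y"

definition n_sample ::
    "('s::finite, 'a::finite, 'm::finite, 'n::finite, 'w) gtd \<Rightarrow> ('n \<Rightarrow> 's \<times> 'a \<times> 's) \<Rightarrow>
      real^('n \<times> ('m + 'm))"
  where "n_sample S y = n_vec (sample_setting S) 0 y"

definition A_sample ::
    "('s::finite, 'a::finite, 'm::finite, 'n::finite, 'w) gtd \<Rightarrow> ('n \<Rightarrow> 's \<times> 'a \<times> 's) \<Rightarrow>
      real^('n \<times> ('m + 'm))^('n \<times> ('m + 'm))"
  where "A_sample S y = transpose (C_net S) ** (mat 1 - step_size S *\<^sub>R R_sample S y)"

definition b_sample ::
    "('s::finite, 'a::finite, 'm::finite, 'n::finite, 'w) gtd \<Rightarrow> ('n \<Rightarrow> 's \<times> 'a \<times> 's) \<Rightarrow>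
      real^('n \<times> ('m + 'm))"
  where "b_sample S y = step_size S *\<^sub>R (transpose (C_net S) *v n_sample S y)"

text \<open>The sample quantities of every time become one fixed function of the joint sample, the
  form that the i.i.d. recursion requires.\<close>

lemma G_mat_joint_sample: "G_mat (sample_setting S) k 0 (joint_sample S i \<omega>) = G_mat S k i \<omega>"
  and g_vec_joint_sample: "g_vec (sample_setting S) k 0 (joint_sample S i \<omega>) = g_vec S k i \<omega>"
  by (simp_all add: sample_setting_def joint_sample_def G_mat_def g_vec_def x_feat_def delta_def xi_def
      importance_def sample_reward_def)

lemma R_mat_eq: "R_mat S i \<omega> = R_sample S (joint_sample S i \<omega>)"
  by (simp add: R_sample_def R_mat_def G_mat_joint_sample)

lemma alpha_opt_sample_setting: "alpha_opt (sample_setting S) = alpha_opt S"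
  by (simp add: alpha_opt_def w_opt_def A_bar_def D_bar_def D_phi_def P_pi_def r_pi_def sample_setting_def)

lemma n_vec_eq: "n_vec S i \<omega> = n_sample S (joint_sample S i \<omega>)"
  by (simp add: n_sample_def n_vec_def G_mat_joint_sample g_vec_joint_sample alpha_opt_sample_setting)

context gtd_setting begin

text \<open>Since \<open>\<alpha>\<^sup>o - (a - \<mu>(G a + g)) = (I - \<mu> G)(\<alpha>\<^sup>o -
  a) + \<mu>(G \<alpha>\<^sup>o + g)\<close>, adaptation is affine in the error. Each column of the
  combination matrix sums to one, so combining iterates combines their errors.\<close>

lemma network_error_Suc:
  "network_error S (Suc i) \<omega> =
    A_sample S (joint_sample S i \<omega>) *v network_error S i \<omega> + b_sample S (joint_sample S i \<omega>)"
proof -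
  let ?\<mu> = "step_size S" and ?a = "alpha_opt S"
  have sum1: "(\<Sum>l\<in>UNIV. combination S $ l $ k) = 1" for k
    using combination(1) by (simp add: left_stochastic_def)
  have "A_sample S (joint_sample S i \<omega>) *v network_error S i \<omega> + b_sample S (joint_sample S i \<omega>)
    = transpose (C_net S) *v (network_error S i \<omega> - ?\<mu> *\<^sub>R (R_mat S i \<omega> *v network_error S i \<omega>)
      + ?\<mu> *\<^sub>R n_vec S i \<omega>)"
    unfolding A_sample_def b_sample_def R_mat_eq n_vec_eq
    by (simp add: matrix_vector_mul_assoc[symmetric] matrix_vector_mult_diff_rdistrib
        matrix_vector_right_distrib scaleR_matrix_vector_assoc[symmetric] matrix_vector_mult_scaleR
        del: transpose_matrix_vector)
  also have "network_error S i \<omega> - ?\<mu> *\<^sub>R (R_mat S i \<omega> *v network_error S i \<omega>) + ?\<mu> *\<^sub>R n_vec S i \<omega>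
      = col_stack (\<lambda>l. ?a - adapt S l i \<omega> (alpha S i l \<omega>))"
    unfolding network_error_def R_mat_def n_vec_def
    by (simp add: block_diag_mult_col_stack col_stack_mult_vec col_stack_add col_stack_diff col_stack_scaleR
        agent_error_def adapt_def algebra_simps)
  also have "transpose (C_net S) *v \<dots>
      = col_stack (\<lambda>k. \<Sum>l\<in>UNIV. combination S $ l $ k *\<^sub>R (?a - adapt S l i \<omega> (alpha S i l \<omega>)))"
    by (simp add: C_net_def transpose_kron_mat_1_mult_col_stack del: transpose_matrix_vector)
  also have "\<dots> = network_error S (Suc i) \<omega>"
    by (simp add: network_error_def agent_error_def scaleR_diff_right sum_subtractf sum1
        flip: scaleR_left.sum)
  finally show ?thesis by simp
qed

section \<open>Joint samples of all agents are independent and identically distributed\<close>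

interpretation prob_space "prob_sp S" by (rule prob_space)

lemma indep_joint_samples:
  "indep_vars (\<lambda>_. count_space UNIV) (joint_sample S) UNIV"
proof -
  let ?X = "\<lambda>(k, i) \<omega>. (state S k i \<omega>, act S k i \<omega>, next_state S k i \<omega>)"
  \<comment> \<open>Group the family over agents and times into the disjoint blocks of a fixed
    time.\<close>
  have "indep_vars (\<lambda>i. PiM (UNIV \<times> {i}) (\<lambda>_. count_space UNIV))
      (\<lambda>i \<omega>. restrict (\<lambda>ki. ?X ki \<omega>) (UNIV \<times> {i})) UNIV"
    by (rule indep_vars_restrict[OF samples_indep]) (auto simp: disjoint_family_on_def)
  then have "indep_vars (\<lambda>_. count_space UNIV)
      (\<lambda>i \<omega>. (\<lambda>f k. f (k, i)) (restrict (\<lambda>ki. ?X ki \<omega>) (UNIV \<times> {i}))) UNIV"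
    by (rule indep_vars_compose2) (simp add: count_space_PiM_finite)
  then show ?thesis by (simp add: joint_sample_def[abs_def])
qed

lemma joint_samples_ident:
  "distr (prob_sp S) (count_space UNIV) (joint_sample S i)
    = distr (prob_sp S) (count_space UNIV) (joint_sample S 0)"
proof -
  let ?X = "\<lambda>(k, i) \<omega>. (state S k i \<omega>, act S k i \<omega>, next_state S k i \<omega>)"
  have PiM_UNIV: "PiM UNIV (\<lambda>k::'n. count_space UNIV) = count_space (UNIV :: ('n \<Rightarrow> 's \<times> 'a \<times> 's) set)"
    by (subst count_space_PiM_finite) auto
  \<comment> \<open>Independence across agents makes the joint law the product of the individual
    laws, in which \<open>i\<close> does not occur.\<close>
  have "distr (prob_sp S) (count_space UNIV) (joint_sample S i) = PiM UNIV (\<lambda>k.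
      measure_pmf (bind_pmf (stat_dist S k) (\<lambda>s. bind_pmf (behavior S k s) (\<lambda>a.
        map_pmf (\<lambda>s'. (s, a, s')) (kernel S s a)))))" for i
  proof -
    have "indep_vars (\<lambda>k. PiM {(k, i)} (\<lambda>_. count_space UNIV))
        (\<lambda>k \<omega>. restrict (\<lambda>ki. ?X ki \<omega>) {(k, i)}) UNIV"
      by (rule indep_vars_restrict[OF samples_indep]) (auto simp: disjoint_family_on_def)
    then have "indep_vars (\<lambda>_. count_space UNIV)
        (\<lambda>k \<omega>. (\<lambda>f. f (k, i)) (restrict (\<lambda>ki. ?X ki \<omega>) {(k, i)})) UNIV"
      by (rule indep_vars_compose2) (simp add: count_space_PiM_finite)
    then have ind: "indep_vars (\<lambda>_. count_space UNIV)
        (\<lambda>k \<omega>. (state S k i \<omega>, act S k i \<omega>, next_state S k i \<omega>)) UNIV"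
      by simp
    then have rv: "random_variable (count_space UNIV)
        (\<lambda>\<omega>. (state S k i \<omega>, act S k i \<omega>, next_state S k i \<omega>))" for k
      by (auto simp: indep_vars_def)
    from ind have "distr (prob_sp S) (PiM UNIV (\<lambda>_. count_space UNIV))
        (\<lambda>\<omega>. \<lambda>k\<in>UNIV. (state S k i \<omega>, act S k i \<omega>, next_state S k i \<omega>))
      = PiM UNIV (\<lambda>k. distr (prob_sp S) (count_space UNIV)
        (\<lambda>\<omega>. (state S k i \<omega>, act S k i \<omega>, next_state S k i \<omega>)))"
      by (subst (asm) indep_vars_iff_distr_eq_PiM') (rule UNIV_not_empty, rule rv)
    then show ?thesis
      by (simp add: PiM_UNIV samples_distr joint_sample_def[abs_def] restrict_UNIV)
  qed
  then show ?thesis by simp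
qed

sublocale rec: iid_affine_recursion "prob_sp S" "joint_sample S"
  "A_sample S" "b_sample S" "col_stack (\<lambda>k. alpha_opt S - init S k)"
  by unfold_locales (rule indep_joint_samples, rule joint_samples_ident)

lemma network_error_eq: "network_error S i \<omega> = rec.e i \<omega>"
proof (induction i)
  case (Suc i)
  then show ?case by (simp add: network_error_Suc rec.e_Suc)
qed (simp add: network_error_def agent_error_def)

section \<open>Identification of the abstract moments with the network quantities\<close>

lemma mean_error_eq: "mean_error S = rec.mean"
  by (simp add: fun_eq_iff mean_error_def rec.mean_def network_error_eq)

lemma R_mean_nth: "R_mean S $ p $ q = rec.expect (\<lambda>y. R_sample S y $ p $ q)"
  by (simp add: R_mean_def R_mat_eq rec.integral_fun_Y_nth_nth[where f = "R_sample S"])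

lemma A_mean_eq: "rec.A_mean = transpose (C_net S) ** (mat 1 - step_size S *\<^sub>R R_mean S)"
  by (simp add: vec_eq_iff rec.A_mean_def A_sample_def matrix_matrix_mult_def R_mean_nth rec.expect_sum
      rec.expect_mult_left rec.expect_diff rec.expect_const)

lemma transpose_A:
  "(mat 1 - step_size S *\<^sub>R transpose R) ** C_net S
    = transpose (transpose (C_net S) ** (mat 1 - step_size S *\<^sub>R R))"
  by (simp add: matrix_transpose_mul transpose_diff transpose_scalar)

text \<open>This is the covariance identity for \<open>A \<otimes> A\<close>: the mean of a product
  is the product of the means plus the mean product of the deviations. The first summand of
  \<open>F_mat\<close> is the former, the second the latter.\<close>

lemma F_mat_eq: "F_mat S = rec.K"
proof (unfold vec_eq_iff, intro allI)
  fix p q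
  let ?A = "A_sample S"
  define B where "B y = (transpose (R_sample S y) - transpose (R_mean S)) ** C_net S" for y
  \<comment> \<open>The deviation of \<open>A_sample\<close> from its mean is, up to sign and
    transposition, \<open>step_size S\<close> times \<open>B\<close>. The two factors in the
    Kronecker product absorb the squared step-size and cancel the sign.\<close>
  have B: "step_size S * B y $ i $ j = rec.A_mean $ j $ i - ?A y $ j $ i" for y i j
  proof -
    have "step_size S *\<^sub>R B y = transpose (rec.A_mean - ?A y)"
      unfolding B_def A_sample_def A_mean_eq transpose_diff transpose_A[symmetric]
      by (simp add: vec_eq_iff matrix_matrix_mult_def sum_distrib_left sum_subtractf[symmetric] algebra_simps)
    then have "(step_size S *\<^sub>R B y) $ i $ j = transpose (rec.A_mean - ?A y) $ i $ j" by (simp only:)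
    then show ?thesis by (simp add: transpose_def)
  qed
  have mean: "rec.expect (\<lambda>y. ?A y $ i $ j) = rec.A_mean $ i $ j" for i j
    by (simp add: rec.A_mean_def)
  have "(step_size S)\<^sup>2 * (B y $ fst p $ fst q * B y $ snd p $ snd q)
      = (rec.A_mean $ fst q $ fst p - ?A y $ fst q $ fst p) * (rec.A_mean $ snd q $ snd p - ?A y $ snd q $ snd p)" for y
    by (simp only: B[symmetric] power2_eq_square mult_ac)
  then have "(step_size S)\<^sup>2 * rec.expect (\<lambda>y. B y $ fst p $ fst q * B y $ snd p $ snd q)
      = rec.expect (\<lambda>y. (rec.A_mean $ fst q $ fst p - ?A y $ fst q $ fst p)
          * (rec.A_mean $ snd q $ snd p - ?A y $ snd q $ snd p))"
    by (simp flip: rec.expect_mult_left)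
  also have "\<dots> = rec.expect (\<lambda>y. ?A y $ fst q $ fst p * ?A y $ snd q $ snd p)
      - rec.A_mean $ fst q $ fst p * rec.A_mean $ snd q $ snd p"
    by (simp add: ring_distribs rec.expect_add rec.expect_diff rec.expect_mult_left rec.expect_mult_right
        rec.expect_const mean)
  finally have "(step_size S)\<^sup>2 * rec.expect (\<lambda>y. B y $ fst p $ fst q * B y $ snd p $ snd q)
      = rec.K $ p $ q - rec.A_mean $ fst q $ fst p * rec.A_mean $ snd q $ snd p"
    by (simp add: rec.K_def)
  moreover have "(\<integral>\<omega>. kron (B (joint_sample S 0 \<omega>)) (B (joint_sample S 0 \<omega>)) \<partial>prob_sp S) $ p $ q
      = rec.expect (\<lambda>y. B y $ fst p $ fst q * B y $ snd p $ snd q)"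
    unfolding rec.integral_fun_Y_nth_nth[where f = "\<lambda>y. kron (B y) (B y)"] by (simp add: kron_def)
  ultimately show "F_mat S $ p $ q = rec.K $ p $ q"
    unfolding F_mat_def transpose_A A_mean_eq[symmetric] R_mat_eq B_def[symmetric]
    by (simp add: kron_def transpose_def)
qed

lemma U_mat_eq: "U_mat S = rec.U"
proof (unfold vec_eq_iff, intro allI)
  fix p j
  let ?f = "\<lambda>y. kron_col (transpose (C_net S) *v n_sample S y) (A_sample S y)"
  have "U_mat S $ p $ j = step_size S * (\<integral>\<omega>. ?f (joint_sample S 0 \<omega>) \<partial>prob_sp S) $ p $ j"
    unfolding U_mat_def R_mat_eq n_vec_eq A_sample_def by simp
  also have "\<dots> = rec.expect (\<lambda>y. step_size S * ?f y $ p $ j)"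
    unfolding rec.integral_fun_Y_nth_nth[where f = ?f] rec.expect_mult_left ..
  finally show "U_mat S $ p $ j = rec.U $ p $ j"
    by (simp add: rec.U_def kron_col_def b_sample_def mult.assoc)
qed

lemma R_noise_nth: "R_noise S $ p $ q = rec.expect (\<lambda>y. n_sample S y $ p * n_sample S y $ q)"
  unfolding R_noise_def n_vec_eq
    rec.integral_fun_Y_nth_nth[where f = "\<lambda>y. outer (n_sample S y) (n_sample S y)"]
  by (simp add: outer_def)

text \<open>Expectation passes through the fixed matrices, which then act on \<open>n_sample\<close>
  itself. The squared step-size is shared between the two factors \<open>b_sample\<close>.\<close>

lemma h_vec_eq: "h_vec S = rec.h"
proof (unfold vec_eq_iff, intro allI)
  fix p
  let ?T = "transpose (C_net S)"
  have "(?T ** R_noise S ** C_net S) $ i $ j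
      = rec.expect (\<lambda>y. (?T ** outer (n_sample S y) (n_sample S y) ** C_net S) $ i $ j)" for i j
    by (simp add: matrix_matrix_mult_def R_noise_nth outer_def rec.expect_sum rec.expect_mult_left
        rec.expect_mult_right)
  also have "\<dots> i j = rec.expect (\<lambda>y. outer (?T *v n_sample S y) (?T *v n_sample S y) $ i $ j)" for i j
    unfolding outer_matrix_vector_mult transpose_transpose ..
  finally show "h_vec S $ p = rec.h $ p"
    by (simp add: h_vec_def rec.h_def vec_cols_def outer_def b_sample_def power2_eq_square rec.expect_mult_left[symmetric] mult_ac)
qed

end

theorem mainTheorem4:
  fixes S :: "('s::finite, 'a::finite, 'm::finite, 'n::finite, 'w) gtd"
  assumes setting: "gtd_setting S"
    and mean_stable:
      "spec_radius (transpose (C_net S) ** (mat 1 - step_size S *\<^sub>R R_mean S)) < 1"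
    and mean_square_stable: "spec_radius (F_mat S) < 1"
  shows "convergent (mean_error S) \<and>
    invertible (mat 1 - F_mat S) \<and>
    (\<forall>\<Sigma> :: real^('n \<times> ('m + 'm))^('n \<times> ('m + 'm)). pos_semidef \<Sigma> \<longrightarrow>
      (\<lambda>i. \<integral>\<omega>. network_error S i \<omega> \<bullet> (\<Sigma> *v network_error S i \<omega>) \<partial>prob_sp S)
        \<longlonglongrightarrow> q_vec S \<bullet> (matrix_inv (mat 1 - F_mat S) *v vec_cols \<Sigma>)) \<and>
    (\<lambda>i. 1 / real CARD('n) *
        (\<Sum>k\<in>UNIV. \<integral>\<omega>. (norm (agent_error S i k \<omega>))\<^sup>2 \<partial>prob_sp S))
      \<longlonglongrightarrow> 1 / real CARD('n) *
        (q_vec S \<bullet> (matrix_inv (mat 1 - F_mat S) *v vec_cols (mat 1))) \<and>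
    (\<forall>k. (\<lambda>i. \<integral>\<omega>. (norm (agent_error S i k \<omega>))\<^sup>2 \<partial>prob_sp S)
      \<longlonglongrightarrow> q_vec S \<bullet> (matrix_inv (mat 1 - F_mat S) *v vec_cols (J_mat k)))"
proof -
  interpret gtd_setting S by (rule setting)
  have mean: "spec_radius rec.A_mean < 1" and square: "spec_radius rec.K < 1"
    using mean_stable mean_square_stable by (simp_all add: A_mean_eq F_mat_eq)
  have quadratic: "(\<lambda>i. \<integral>\<omega>. network_error S i \<omega> \<bullet> (\<Sigma> *v network_error S i \<omega>) \<partial>prob_sp S)
      \<longlonglongrightarrow> q_vec S \<bullet> (matrix_inv (mat 1 - F_mat S) *v vec_cols \<Sigma>)"
    if "transpose \<Sigma> = \<Sigma>" for \<Sigma>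
    using rec.quadratic_form_limit[OF mean square that]
    by (simp add: network_error_eq q_vec_def h_vec_eq U_mat_eq F_mat_eq error_limit_def mean_error_eq)
  have agent: "(\<lambda>i. \<integral>\<omega>. (norm (agent_error S i k \<omega>))\<^sup>2 \<partial>prob_sp S)
      \<longlonglongrightarrow> q_vec S \<bullet> (matrix_inv (mat 1 - F_mat S) *v vec_cols (J_mat k))" for k
    using quadratic[OF transpose_J_mat] by (simp add: network_error_def J_mat_quadratic_form)
  \<comment> \<open>The matrices \<open>J_mat k\<close> sum to the identity, so the network
    deviation follows by adding the agents' limits.\<close>
  have sum_eq: "(\<Sum>k\<in>UNIV. q_vec S \<bullet> (matrix_inv (mat 1 - F_mat S) *v vec_cols (J_mat k)))
      = q_vec S \<bullet> (matrix_inv (mat 1 - F_mat S) *v vec_cols (\<Sum>k\<in>UNIV. J_mat k))"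
    by (simp add: vec_cols_sum inner_sum_right linear_sum[OF matrix_vector_mul_linear])
  have network: "(\<lambda>i. 1 / real CARD('n) *
        (\<Sum>k\<in>UNIV. \<integral>\<omega>. (norm (agent_error S i k \<omega>))\<^sup>2 \<partial>prob_sp S))
      \<longlonglongrightarrow> 1 / real CARD('n) * (q_vec S \<bullet> (matrix_inv (mat 1 - F_mat S) *v vec_cols (mat 1)))"
    unfolding sum_eq[unfolded sum_J_mat, symmetric]
    by (intro tendsto_mult tendsto_const tendsto_sum agent)
  \<comment> \<open>\<open>lim\<close> and \<open>matrix_inv\<close> are total, so convergence and
    invertibility are proved alongside to ensure that they denote a true limit and a true
    inverse.\<close>
  show ?thesis
    using rec.convergent_mean[OF mean square] quadratic network agent
      invertible_mat_1_minus[OF mean_square_stable]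
    by (simp add: mean_error_eq pos_semidef_def)
qed

end
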